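(* There exists a quasiregular mapping $p:\mathbb{R}^2\to\mathbb{R}^2$ of polynomial type with $\deg p>K(p)$ such that: (i) there is a domain $W\subset\mathbb{R}^2$ which is both a wandering component of $\mathbb{R}^2\setminus\overline{I(p)}$ and a wandering component of the Fatou set $F(p)$; and (ii) $J(p)\neq\partial I(p)$.
   Context: A continuous function $f:G\to\mathbb{R}^2$ on a domain $G\subseteq\mathbb{R}^2$ is $K$-quasiregular if it belongs to the Sobolev space $W^1_{2,\mathrm{loc}}(G)$ and $|Df(x)|^2\le K J_f(x)$ for almost every $x\in G$, where $Df(x)$ is the formal derivative, $|Df(x)|=\sup_{|a|=1}|Df(x)a|$ is its operator norm, and $J_f(x)$ is the Jacobian determinant. The least $K\ge 1$ for which this holds is the dilatation $K(f)$. A function is quasiregular if it is $K$-quasiregular for some $K$. A non-constant quasiregular mapping $f:\mathbb{R}^2\to\mathbb{R}^2$ is of polynomial type if $f(x)\to\infty$ as $x\to\infty$. Its degree is $\deg f=\sup_{y\in\mathbb{R}^2}|f^{-1}(y)|$, the maximal number of pre-images of any value. Let $p^n$ denote the $n$-th iterate of $p$. The escaping set is $I(p)=\{x\in\mathbb{R}^2: p^n(x)\to\infty \text{ as } n\to\infty\}$. The Fatou set $F(p)$ is the set of $x\in\mathbb{R}^2$ having a neighbourhood $U$ such that $\{p^n|_U\}$ is a normal family (locally uniform convergence to $\infty$ is allowed, i.e. normality is with respect to the spherical metric on the target). The Julia set $J(p)$ is the set of $x\in\mathbb{R}^2$ such that for every neighbourhood $U$ of $x$, the union $\bigcup_n p^n(U)$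 of the forward images contains all but at most one point of $\mathbb{R}^2$. If an open set $U$ is completely invariant under $f$, $U_0$ is a connected component of $U$, and $U_n$ denotes the component of $U$ containing $f^n(U_0)$, then $U_0$ is called a wandering component (or wandering domain) of $U$ if $U_n\neq U_m$ whenever $n\neq m$. (The open sets $\mathbb{R}^2\setminus\overline{I(p)}$ and $F(p)$ are completely invariant under $p$.) *)

theory Defs
  imports "HOL-Analysis.Analysis"
begin

type_synonym plane = "real^2"


section \<open>Quasiregular mappings of the plane\<close>

primrec C_diff :: "nat \<Rightarrow> (plane \<Rightarrow> real) \<Rightarrow> bool" where
  "C_diff 0 \<phi> \<longleftrightarrow> continuous_on UNIV \<phi>"
| "C_diff (Suc k) \<phi> \<longleftrightarrow> (\<forall>x. \<phi> differentiable (at x)) \<and>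
     (\<forall>j. C_diff k (\<lambda>x. frechet_derivative \<phi> (at x) (axis j 1)))"

definition test_function :: "plane set \<Rightarrow> (plane \<Rightarrow> real) \<Rightarrow> bool" where
  "test_function G \<phi> \<longleftrightarrow> (\<forall>k. C_diff k \<phi>) \<and>
     compact (closure {x. \<phi> x \<noteq> 0}) \<and> closure {x. \<phi> x \<noteq> 0} \<subseteq> G"

definition locally_L2 :: "plane set \<Rightarrow> (plane \<Rightarrow> real) \<Rightarrow> bool" where
  "locally_L2 G u \<longleftrightarrow> set_borel_measurable lebesgue G u \<and>
     (\<forall>C. compact C \<and> C \<subseteq> G \<longrightarrow> set_integrable lebesgue C (\<lambda>x. (u x)\<^sup>2))"

text \<open>The integrals below exist whenever \<open>u\<close> and \<open>v\<close> are locally square integrable, the only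
  case in which the notion is used.\<close>

definition weak_partial :: "plane set \<Rightarrow> 2 \<Rightarrow> (plane \<Rightarrow> real) \<Rightarrow> (plane \<Rightarrow> real) \<Rightarrow> bool" where
  "weak_partial G j u v \<longleftrightarrow> (\<forall>\<phi>. test_function G \<phi> \<longrightarrow>
     (LINT x:G|lebesgue. u x * frechet_derivative \<phi> (at x) (axis j 1)) =
     - (LINT x:G|lebesgue. v x * \<phi> x))"

text \<open>\<open>f\<close> lies in \<open>W\<^sup>1\<close> with exponent 2, locally in \<open>G\<close>, and \<open>D\<close> is a version of its formal
  derivative: the entry \<open>D x $ i $ j\<close> is the weak \<open>j\<close>-th partial derivative of the \<open>i\<close>-th
  component of \<open>f\<close>. It is determined by \<open>f\<close> almost everywhere in \<open>G\<close>.\<close>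

definition W12_loc_deriv :: "plane set \<Rightarrow> (plane \<Rightarrow> plane) \<Rightarrow> (plane \<Rightarrow> real^2^2) \<Rightarrow> bool" where
  "W12_loc_deriv G f D \<longleftrightarrow>
     (\<forall>i. locally_L2 G (\<lambda>x. f x $ i)) \<and>
     (\<forall>i j. locally_L2 G (\<lambda>x. D x $ i $ j) \<and>
            weak_partial G j (\<lambda>x. f x $ i) (\<lambda>x. D x $ i $ j))"

text \<open>The constant has to be at least 1: with negative \<open>K\<close> the inequality would admit
  orientation-reversing maps.\<close>

definition K_quasiregular :: "real \<Rightarrow> plane set \<Rightarrow> (plane \<Rightarrow> plane) \<Rightarrow> bool" where
  "K_quasiregular K G f \<longleftrightarrow> K \<ge> 1 \<and>
     open G \<and> connected G \<and> G \<noteq> {} \<and> continuous_on G f \<and>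
     (\<exists>D. W12_loc_deriv G f D \<and>
          (AE x\<in>G in lebesgue. (onorm ((*v) (D x)))\<^sup>2 \<le> K * det (D x)))"

definition quasiregular :: "plane set \<Rightarrow> (plane \<Rightarrow> plane) \<Rightarrow> bool" where
  "quasiregular G f \<longleftrightarrow> (\<exists>K. K_quasiregular K G f)"

text \<open>For quasiregular \<open>f\<close> the infimum is attained, because the formal derivative is unique up to
  a null set and the inequality is closed in \<open>K\<close>; so this is the least admissible constant.\<close>

definition dilatation :: "plane set \<Rightarrow> (plane \<Rightarrow> plane) \<Rightarrow> real" where
  "dilatation G f = Inf {K. K_quasiregular K G f}"

definition polynomial_type :: "(plane \<Rightarrow> plane) \<Rightarrow> bool" where
  "polynomial_type f \<longleftrightarrow> quasiregular UNIV f \<and> \<not> f constant_on UNIV \<and>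
     filterlim f at_infinity at_infinity"

definition ecardinal :: "'a set \<Rightarrow> enat" where
  "ecardinal A = (if finite A then enat (card A) else \<infinity>)"

definition map_degree :: "(plane \<Rightarrow> plane) \<Rightarrow> enat" where
  "map_degree f = (SUP y. ecardinal (f -` {y}))"


section \<open>Dynamics\<close>

definition escaping_set :: "(plane \<Rightarrow> plane) \<Rightarrow> plane set" where
  "escaping_set p = {x. filterlim (\<lambda>n. (p ^^ n) x) at_infinity sequentially}"

text \<open>The extended plane is modelled by the unit sphere of \<open>\<real>\<^sup>2 \<times> \<real>\<close>, with \<open>\<infinity>\<close> as the north pole
  \<open>(0, 1)\<close>; the plane embeds by inverse stereographic projection. The Euclidean distance on the
  sphere is the chordal metric, which is equivalent (bi-Lipschitz) to the geodesic one.\<close>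

definition to_sphere :: "plane \<Rightarrow> plane \<times> real" where
  "to_sphere x = ((2 / ((norm x)\<^sup>2 + 1)) *\<^sub>R x, ((norm x)\<^sup>2 - 1) / ((norm x)\<^sup>2 + 1))"

definition locally_uniform_limit ::
    "plane set \<Rightarrow> (nat \<Rightarrow> plane \<Rightarrow> plane \<times> real) \<Rightarrow> (plane \<Rightarrow> plane \<times> real) \<Rightarrow> bool" where
  "locally_uniform_limit U h g \<longleftrightarrow>
     (\<forall>x\<in>U. \<exists>V. open V \<and> x \<in> V \<and> V \<subseteq> U \<and> uniform_limit V h g sequentially)"

definition normal_family :: "plane set \<Rightarrow> (plane \<Rightarrow> plane) set \<Rightarrow> bool" where
  "normal_family U \<F> \<longleftrightarrow>
     (\<forall>s :: nat \<Rightarrow> plane \<Rightarrow> plane. range s \<subseteq> \<F> \<longrightarrow>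
        (\<exists>r g. strict_mono r \<and> g ` U \<subseteq> sphere 0 1 \<and>
               locally_uniform_limit U (\<lambda>k. to_sphere \<circ> s (r k)) g))"

definition fatou_set :: "(plane \<Rightarrow> plane) \<Rightarrow> plane set" where
  "fatou_set p = {x. \<exists>U. open U \<and> x \<in> U \<and> normal_family U (range (\<lambda>n. p ^^ n))}"

definition julia_set :: "(plane \<Rightarrow> plane) \<Rightarrow> plane set" where
  "julia_set p = {x. \<forall>U. open U \<and> x \<in> U \<longrightarrow> (\<exists>a. UNIV - {a} \<subseteq> (\<Union>n. (p ^^ n) ` U))}"

definition completely_invariant :: "('a \<Rightarrow> 'a) \<Rightarrow> 'a set \<Rightarrow> bool" where
  "completely_invariant f U \<longleftrightarrow> (\<forall>x. f x \<in> U \<longleftrightarrow> x \<in> U)"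

definition wandering_component :: "(plane \<Rightarrow> plane) \<Rightarrow> plane set \<Rightarrow> plane set \<Rightarrow> bool" where
  "wandering_component f U U\<^sub>0 \<longleftrightarrow>
     open U \<and> completely_invariant f U \<and> U\<^sub>0 \<in> components U \<and>
     (\<exists>V :: nat \<Rightarrow> plane set.
        (\<forall>n. V n \<in> components U \<and> (f ^^ n) ` U\<^sub>0 \<subseteq> V n) \<and>
        (\<forall>n m. n \<noteq> m \<longrightarrow> V n \<noteq> V m))"

end

theory Submission
  imports Defs "HOL-Complex_Analysis.Conformal_Mappings"
begin

text \<open>The example \<open>wander\<close> is a small modification of \<open>z + z\<^sup>5 / 40000\<close>, which has degree 5.
A cut-off turns this polynomial into a map that is the identity on \<open>\<bar>z\<bar>\<^sup>2 \<le> 2\<close>; as the coefficient is small,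
the cut-off costs almost no dilatation. The result is followed by \<open>(x, y) \<mapsto> (x / 2, 5 y / 4)\<close>, so that
near the origin the map is a linear saddle, while far away it still behaves like a polynomial of degree 5.
On the vertical axis, which is mapped into itself, everything except the origin escapes, because
there the fifth power has the same sign as the linear term.

The saddle is then changed in a thin set along the positive horizontal axis. A height
function \<open>b\<close> on \<open>(0, 1)\<close> with \<open>b (x / 2) = b x / 2\<close>, positive except at the points \<open>(1/2)\<^sup>n\<close>, bounds a chain of
beads \<open>\<bar>y\<bar> < b x\<close> that touch at these points. On the beads the vertical expansion is replaced by the
contraction \<open>1/2\<close>, so that the map halves every bead onto the next one. Above and below the chain the excess
\<open>\<bar>y\<bar> - b x\<close> still grows at least by the factor \<open>5/4\<close> in each step, while \<open>x\<close> is halved. A point that starts outside the chain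
but very close to it is therefore pushed away from the chain only when \<open>x\<close> has become tiny, hence arrives close to
a compact piece of the punctured vertical axis, and escapes since the escaping set is open
(\<open>escaping_near_chain\<close>).

So the boundary of every bead, including the touching points, lies in the closure of the escaping
set, while the orbits in the beads converge to the origin. This makes each bead a component of the complement of that closure. The beads are also
components of the Fatou set: on a bead the iterates converge uniformly to 0, and at a
boundary point a limit of iterates would have to be both 0 and \<open>\<infinity>\<close>. The beads move along the
chain forever, so they wander.

For the Julia set, a neighbourhood of a boundary point of the chain can be chosen
to consist of escaping points and of points of the chain with positive abscissa. Its forward images omit all points of the
horizontal axis with abscissa in \<open>[-1, 0]\<close>, since those do not escape and are not hit by the chain. Hence this boundary
point of the escaping set is not in the Julia set.

The dilatation is at most \<open>9/2 < 5\<close>. The map is Lipschitz on bounded sets and differentiable off a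
null set of circles and graphs, and for such maps the pointwise derivative is a weak derivative
(\<open>K_quasiregular_of_lipschitz\<close>), so it suffices to bound the Jacobian matrix pointwise. Complete
invariance of the two open sets needs that \<open>wander\<close> is an open map; this follows from invariance of
domain where the map is injective, and from the open mapping theorem for the polynomial elsewhere.\<close>

section \<open>Weak derivatives of Lipschitz maps\<close>

lemma difference_quotient_LIMSEQ:
  fixes f :: "'a::real_normed_vector \<Rightarrow> real"
  assumes "(f has_derivative D) (at x)"
  shows "(\<lambda>n. real (Suc n) * (f (x + (1 / real (Suc n)) *\<^sub>R e) - f x)) \<longlonglongrightarrow> D e"
proof -
  interpret D: bounded_linear D by (rule has_derivative_bounded_linear[OF assms])
  have "((\<lambda>t. x + t *\<^sub>R e) has_derivative (\<lambda>t. t *\<^sub>R e)) (at 0)"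
    by (auto intro!: derivative_eq_intros)
  moreover have "(f has_derivative D) (at (x + 0 *\<^sub>R e))"
    using assms by simp
  ultimately have "((\<lambda>t. f (x + t *\<^sub>R e)) has_derivative (\<lambda>t. D (t *\<^sub>R e))) (at 0)"
    using has_derivative_compose by blast
  then have "((\<lambda>t. f (x + t *\<^sub>R e)) has_field_derivative D e) (at 0)"
    by (rule has_derivative_imp_has_field_derivative) (simp add: D.scaleR)
  then have lim: "((\<lambda>h. (f (x + h *\<^sub>R e) - f x) / h) \<longlongrightarrow> D e) (at 0)"
    using DERIV_D by fastforce
  have "filterlim (\<lambda>n. 1 / real (Suc n)) (at 0) sequentially"
    unfolding filterlim_at
    using LIMSEQ_Suc[OF lim_1_over_n[where 'a = real]] by (auto simp del: of_nat_Suc)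
  from filterlim_compose[OF lim this] show ?thesis
    by (simp add: field_simps)
qed

lemma continuous_on_of_lipschitz_on_balls:
  fixes u :: "'a::real_normed_vector \<Rightarrow> 'b::metric_space"
  assumes "\<And>r. \<exists>L. L-lipschitz_on (cball 0 r) u"
  shows "continuous_on UNIV u"
proof -
  have "isCont u x" for x
  proof -
    obtain L where "L-lipschitz_on (cball 0 (norm x + 1)) u" using assms by blast
    then have "continuous_on (cball 0 (norm x + 1)) u" by (rule lipschitz_on_continuous_on)
    moreover have "x \<in> interior (cball 0 (norm x + 1))"
      by (rule interiorI[of "ball 0 (norm x + 1)"]) auto
    ultimately show ?thesis by (rule continuous_on_interior)
  qed
  then show ?thesis by (simp add: continuous_on_eq_continuous_at)
qed

lemma integrable_continuous_bounded_support:
  fixes f :: "'a::euclidean_space \<Rightarrow> real"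
  assumes "continuous_on UNIV f" "\<And>x. norm x > R \<Longrightarrow> f x = 0"
  shows "integrable lborel f"
proof -
  have "integrable lborel (\<lambda>x. indicator (cball 0 R) x *\<^sub>R f x)"
    by (rule borel_integrable_compact) (auto intro: continuous_on_subset[OF assms(1)])
  also have "(\<lambda>x. indicator (cball 0 R) x *\<^sub>R f x) = f"
    using assms(2) by (force simp: indicator_def)
  finally show ?thesis .
qed

lemma lborel_integral_translate:
  fixes f :: "'a::euclidean_space \<Rightarrow> real"
  assumes [measurable]: "f \<in> borel_measurable borel"
  shows "(LINT x|lborel. f (c + x)) = (LINT x|lborel. f x)"
proof -
  have "(LINT x|lborel. f x) = (LINT x|distr lborel borel ((+) c). f x)"
    by (simp add: lborel_distr_plus)
  also have "\<dots> = (LINT x|lborel. f (c + x))"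
    by (rule integral_distr) auto
  finally show ?thesis by simp
qed

text \<open>Discrete integration by parts: by translation invariance of Lebesgue measure, a forward difference
quotient can be moved from the test function to a backward difference quotient of \<open>u\<close>. Both
quotients are bounded, the latter by the Lipschitz condition, so dominated convergence applies on both sides.\<close>

lemma weak_partial_of_lipschitz:
  fixes u v :: "plane \<Rightarrow> real"
  assumes lip: "\<And>r. \<exists>L. L-lipschitz_on (cball 0 r) u"
    and v[measurable]: "v \<in> borel_measurable borel"
    and deriv: "AE x in lborel. \<exists>D. (u has_derivative D) (at x) \<and> D (axis j 1) = v x"
  shows "weak_partial UNIV j u v"
  unfolding weak_partial_def
proof (intro allI impI)
  fix \<phi> :: "plane \<Rightarrow> real"
  assume \<phi>: "test_function UNIV \<phi>"
  define e :: plane where "e = axis j 1"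
  define g where "g x = frechet_derivative \<phi> (at x) e" for x
  have ne[simp]: "norm e = 1" by (simp add: e_def)
  have ediv[simp]: "norm ((1 / real (Suc n)) *\<^sub>R e) \<le> 1" for n
    using ne by simp
  have "C_diff (Suc 0) \<phi>" using \<phi> unfolding test_function_def by blast
  then have diff: "\<phi> differentiable (at x)" and gc: "continuous_on UNIV g" for x
    by (auto simp: g_def e_def)
  have der: "(\<phi> has_derivative frechet_derivative \<phi> (at x)) (at x)" for x
    using diff frechet_derivative_works by blast
  have \<phi>c: "continuous_on UNIV \<phi>"
    using diff by (simp add: differentiable_imp_continuous_on differentiable_on_def differentiable_at_imp_differentiable_on)
  have uc: "continuous_on UNIV u" by (rule continuous_on_of_lipschitz_on_balls[OF lip])
  have [measurable]: "\<phi> \<in> borel_measurable borel" "u \<in> borel_measurable borel" "g \<in> borel_measurable borel"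
    using \<phi>c uc gc by (auto intro: borel_measurable_continuous_onI)
  have "bounded (closure {x. \<phi> x \<noteq> 0})"
    using \<phi> compact_imp_bounded unfolding test_function_def by blast
  then obtain r where r: "closure {x. \<phi> x \<noteq> 0} \<subseteq> cball 0 r" "r > 0"
    by (force simp: bounded_pos)
  have \<phi>0: "\<phi> x = 0" if "norm x > r" for x
    using r(1) closure_subset[of "{x. \<phi> x \<noteq> 0}"] that by fastforce
  have bdd: "\<exists>B. \<forall>x\<in>cball 0 R. \<bar>f x\<bar> \<le> B" if "continuous_on UNIV f" for f :: "plane \<Rightarrow> real" and R
  proof -
    have "bounded (f ` cball 0 R)"
      by (intro compact_imp_bounded compact_continuous_image continuous_on_subset[OF that]) auto
    then show ?thesis by (auto simp: bounded_iff)
  qed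
  obtain B where B: "\<And>x. x \<in> cball 0 (r+2) \<Longrightarrow> \<bar>g x\<bar> \<le> B" using bdd[OF gc] by blast
  obtain M where M: "\<And>x. x \<in> cball 0 (r+2) \<Longrightarrow> \<bar>u x\<bar> \<le> M" using bdd[OF uc] by blast
  obtain C where C: "\<And>x. x \<in> cball 0 (r+2) \<Longrightarrow> \<bar>\<phi> x\<bar> \<le> C" using bdd[OF \<phi>c] by blast
  obtain L where L: "L-lipschitz_on (cball 0 (r+2)) u" using lip by blast
  have M0: "M \<ge> 0" "B \<ge> 0" "C \<ge> 0" "L \<ge> 0"
    using M[of 0] B[of 0] C[of 0] r(2) lipschitz_on_nonneg[OF L] by auto
  define q where "q n x = real (Suc n) * (\<phi> (x + (1 / real (Suc n)) *\<^sub>R e) - \<phi> x)" for n x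
  define q' where "q' n x = real (Suc n) * (u (x + (1 / real (Suc n)) *\<^sub>R (- e)) - u x)" for n x
  have qm[measurable]: "q n \<in> borel_measurable borel" "q' n \<in> borel_measurable borel" for n
    unfolding q_def q'_def by measurable
  have qb: "\<bar>q n x\<bar> \<le> B * indicator (cball 0 (r+1)) x" for n x
  proof (cases "norm x \<le> r + 1")
    case True
    define h where "h = 1 / real (Suc n)"
    have h: "0 < h" "h \<le> 1" by (auto simp: h_def)
    have d: "((\<lambda>t. \<phi> (x + t *\<^sub>R e)) has_field_derivative g (x + t *\<^sub>R e)) (at t)" for t
    proof -
      interpret D: bounded_linear "frechet_derivative \<phi> (at (x + t *\<^sub>R e))"
        by (rule has_derivative_bounded_linear[OF der])
      have "((\<lambda>t. x + t *\<^sub>R e) has_derivative (\<lambda>t. t *\<^sub>R e)) (at t)"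
        by (auto intro!: derivative_eq_intros)
      from has_derivative_compose[OF this der]
      show ?thesis
        by (rule has_derivative_imp_has_field_derivative) (simp add: D.scaleR g_def)
    qed
    obtain s where s: "0 < s" "s < h" "\<phi> (x + h *\<^sub>R e) - \<phi> (x + 0 *\<^sub>R e) = (h - 0) * g (x + s *\<^sub>R e)"
      using MVT2[OF h(1), of "\<lambda>t. \<phi> (x + t *\<^sub>R e)" "\<lambda>t. g (x + t *\<^sub>R e)"] d by blast
    have "norm (x + s *\<^sub>R e) \<le> norm x + s" using norm_triangle_ineq[of x "s *\<^sub>R e"] s by simp
    then have "\<bar>g (x + s *\<^sub>R e)\<bar> \<le> B" using B True s h by simp
    moreover have "q n x = g (x + s *\<^sub>R e)"
      using s(3) h(1) unfolding q_def h_def[symmetric] by (simp add: h_def)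
    ultimately show ?thesis using True by simp
  next
    case False
    have "norm (x + (1 / real (Suc n)) *\<^sub>R e) \<ge> norm x - norm ((1 / real (Suc n)) *\<^sub>R e)"
      by (metis norm_diff_ineq)
    then have "norm (x + (1 / real (Suc n)) *\<^sub>R e) > r" using ediv[of n] False by linarith
    then show ?thesis using False \<phi>0 by (simp add: q_def)
  qed
  have q'b: "\<bar>q' n x * \<phi> x\<bar> \<le> (L * C) * indicator (cball 0 r) x" for n x
  proof (cases "norm x \<le> r")
    case True
    have "norm (x + (1 / real (Suc n)) *\<^sub>R (- e)) \<le> norm x + norm ((1 / real (Suc n)) *\<^sub>R (- e))"
      by (rule norm_triangle_ineq)
    then have "norm (x + (1 / real (Suc n)) *\<^sub>R (- e)) \<le> r + 2"
      using ediv[of n] True unfolding scaleR_minus_right norm_minus_cancel by linarith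
    then have "\<bar>u (x + (1 / real (Suc n)) *\<^sub>R (- e)) - u x\<bar> \<le> L * (1 / real (Suc n))"
      using lipschitz_onD[OF L, of "x + (1 / real (Suc n)) *\<^sub>R (- e)" x, unfolded mem_cball_0] True
      by (simp add: dist_norm)
    then have "real (Suc n) * \<bar>u (x + (1 / real (Suc n)) *\<^sub>R (- e)) - u x\<bar>
        \<le> real (Suc n) * (L * (1 / real (Suc n)))"
      by (rule mult_left_mono) simp
    then have "\<bar>q' n x\<bar> \<le> L"
      by (simp only: q'_def abs_mult abs_of_nat) simp
    moreover have "\<bar>\<phi> x\<bar> \<le> C" using C True by simp
    ultimately show ?thesis using True M0 by (simp add: abs_mult mult_mono)
  next
    case False then show ?thesis using \<phi>0 by simp
  qed
  have limq: "(\<lambda>n. q n x) \<longlonglongrightarrow> g x" for x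
    using difference_quotient_LIMSEQ[OF der[of x], of e] by (simp add: q_def g_def)
  have limq': "AE x in lborel. (\<lambda>n. q' n x) \<longlonglongrightarrow> - v x"
    using deriv
  proof eventually_elim
    case (elim x)
    then obtain D where D: "(u has_derivative D) (at x)" "D e = v x" unfolding e_def by blast
    interpret D: bounded_linear D by (rule has_derivative_bounded_linear[OF D(1)])
    show ?case
      using difference_quotient_LIMSEQ[OF D(1), of "-e"] by (simp add: q'_def D(2) D.scaleR[of "-1" e, simplified])
  qed
  have fin: "emeasure lborel (cball (0::plane) R) < \<infinity>" for R
    by (rule emeasure_bounded_finite) simp
  have lim1: "(\<lambda>n. LINT x|lborel. u x * q n x) \<longlonglongrightarrow> (LINT x|lborel. u x * g x)"
  proof (rule integral_dominated_convergence)
    show "integrable lborel (\<lambda>x::plane. (M * B) * indicator (cball 0 (r+1)) x :: real)"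
      by (intro integrable_mult_right integrable_real_indicator) (use fin in auto)
    show "AE x in lborel. (\<lambda>n. u x * q n x) \<longlonglongrightarrow> u x * g x"
      by (intro AE_I2 tendsto_intros limq)
    show "AE x in lborel. norm (u x * q n x) \<le> (M * B) * indicator (cball 0 (r+1)) x" for n
    proof (rule AE_I2)
      fix x :: plane
      show "norm (u x * q n x) \<le> (M * B) * indicator (cball 0 (r+1)) x"
        using qb[of n x] M[of x] M0
        by (cases "norm x \<le> r + 1") (auto simp: abs_mult intro!: mult_mono)
    qed
  qed auto
  have lim2: "(\<lambda>n. LINT x|lborel. q' n x * \<phi> x) \<longlonglongrightarrow> (LINT x|lborel. - v x * \<phi> x)"
  proof (rule integral_dominated_convergence)
    show "integrable lborel (\<lambda>x::plane. (L * C) * indicator (cball 0 r) x :: real)"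
      by (intro integrable_mult_right integrable_real_indicator) (use fin in auto)
    show "AE x in lborel. (\<lambda>n. q' n x * \<phi> x) \<longlonglongrightarrow> - v x * \<phi> x"
      using limq' by eventually_elim (intro tendsto_intros)
    show "AE x in lborel. norm (q' n x * \<phi> x) \<le> (L * C) * indicator (cball 0 r) x" for n
      by (rule AE_I2) (use q'b in simp)
  qed auto
  \<comment> \<open>The shift by \<open>h\<close> is moved from \<open>\<phi>\<close> to \<open>u\<close> by a translation.\<close>
  have eq: "(LINT x|lborel. u x * q n x) = (LINT x|lborel. q' n x * \<phi> x)" for n
  proof -
    define h where "h = (1 / real (Suc n)) *\<^sub>R e"
    have h1: "norm h \<le> 1" using ediv by (simp add: h_def)
    have ha: "norm (x + h) > r" if "norm x > r + 1" for x
      using norm_diff_ineq[of x h] h1 that by linarith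
    have i1: "integrable lborel (\<lambda>x. u x * \<phi> (x + h))"
      using ha \<phi>0
      by (intro integrable_continuous_bounded_support[of _ "r+1"] continuous_intros
            uc continuous_on_compose2[OF \<phi>c]) auto
    have i2: "integrable lborel (\<lambda>x. u x * \<phi> x)"
      using \<phi>0
      by (intro integrable_continuous_bounded_support[of _ "r"] continuous_intros uc \<phi>c) auto
    have i3: "integrable lborel (\<lambda>x. u (x - h) * \<phi> x)"
      using \<phi>0
      by (intro integrable_continuous_bounded_support[of _ "r"] continuous_intros \<phi>c
           continuous_on_compose2[OF uc]) auto
    have "(LINT x|lborel. u x * \<phi> (x + h)) = (LINT x|lborel. u (x - h) * \<phi> x)"
      using lborel_integral_translate[of "\<lambda>x. u (x - h) * \<phi> x" h] by (simp add: add.commute)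
    then have "(LINT x|lborel. u x * \<phi> (x + h) - u x * \<phi> x) = (LINT x|lborel. u (x - h) * \<phi> x - u x * \<phi> x)"
      by (simp add: i1 i2 i3)
    then have "(LINT x|lborel. real (Suc n) * (u x * \<phi> (x + h) - u x * \<phi> x)) =
        (LINT x|lborel. real (Suc n) * (u (x - h) * \<phi> x - u x * \<phi> x))"
      by (simp only: integral_mult_right_zero)
    then show ?thesis
      by (simp add: q_def q'_def h_def algebra_simps)
  qed
  have main: "(LINT x|lborel. u x * g x) = (LINT x|lborel. - v x * \<phi> x)"
    using LIMSEQ_unique[OF lim1] lim2 unfolding eq by blast
  have "(LINT x|lebesgue. u x * g x) = (LINT x|lborel. u x * g x)"
    by (rule integral_completion) measurable
  moreover have "(LINT x|lebesgue. v x * \<phi> x) = (LINT x|lborel. v x * \<phi> x)"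
    by (rule integral_completion) measurable
  ultimately show "(LINT x:UNIV|lebesgue. u x * frechet_derivative \<phi> (at x) (axis j 1)) =
     - (LINT x:UNIV|lebesgue. v x * \<phi> x)"
    using main by (simp add: set_lebesgue_integral_def g_def e_def)
qed

lemma locally_L2_of_locally_bounded:
  fixes u :: "plane \<Rightarrow> real"
  assumes [measurable]: "u \<in> borel_measurable borel"
    and bdd: "\<And>r. \<exists>B. AE x in lborel. norm x \<le> r \<longrightarrow> \<bar>u x\<bar> \<le> B"
  shows "locally_L2 UNIV u"
  unfolding locally_L2_def
proof (intro conjI allI impI)
  show "set_borel_measurable lebesgue UNIV u"
    unfolding set_borel_measurable_def by (simp add: measurable_completion)
next
  fix C :: "plane set" assume C: "compact C \<and> C \<subseteq> UNIV"
  have [measurable]: "C \<in> sets borel" using C by (simp add: borel_compact)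
  obtain r where r: "\<And>x. x \<in> C \<Longrightarrow> norm x \<le> r"
    using C compact_imp_bounded bounded_iff by metis
  obtain B where B: "AE x in lborel. norm x \<le> r \<longrightarrow> \<bar>u x\<bar> \<le> B" using bdd by blast
  have fin: "emeasure lborel C < \<infinity>" using C by (intro emeasure_bounded_finite compact_imp_bounded) auto
  have "integrable lborel (\<lambda>x. indicator C x *\<^sub>R (u x)\<^sup>2)"
  proof (rule Bochner_Integration.integrable_bound)
    show "integrable lborel (\<lambda>x. B\<^sup>2 * indicator C x :: real)"
      using fin by (intro integrable_mult_right integrable_real_indicator) auto
    show "AE x in lborel. norm (indicator C x *\<^sub>R (u x)\<^sup>2) \<le> norm (B\<^sup>2 * indicator C x :: real)"
      using B
    proof eventually_elim
      case (elim x)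
      show ?case
      proof (cases "x \<in> C")
        case True
        then have "\<bar>u x\<bar> \<le> B" using elim r by blast
        then have "(u x)\<^sup>2 \<le> B\<^sup>2" by (rule power2_le_iff_abs_le[THEN iffD2, rotated]) (use \<open>\<bar>u x\<bar> \<le> B\<close> in linarith)
        then show ?thesis using True by simp
      qed simp
    qed
  qed measurable
  then have "integrable lebesgue (\<lambda>x. indicator C x *\<^sub>R (u x)\<^sup>2)"
    by (subst integrable_completion) auto
  then show "set_integrable lebesgue C (\<lambda>x. (u x)\<^sup>2)"
    unfolding set_integrable_def .
qed

text \<open>The squared Frobenius norm dominates the squared operator norm and is a polynomial in the entries.\<close>

definition frobenius_sq :: "real^2^2 \<Rightarrow> real" where
  "frobenius_sq A = (A$1$1)\<^sup>2 + (A$1$2)\<^sup>2 + (A$2$1)\<^sup>2 + (A$2$2)\<^sup>2"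

lemma onorm_sq_le_frobenius: "(onorm ((*v) A))\<^sup>2 \<le> frobenius_sq A"
proof -
  have "norm (A *v x) \<le> sqrt (frobenius_sq A) * norm x" for x
  proof (rule power2_le_imp_le)
    have cs: "(a * s + b * t)\<^sup>2 \<le> (a\<^sup>2 + b\<^sup>2) * (s\<^sup>2 + t\<^sup>2)" for a b s t :: real
      using zero_le_power2[of "a * t - b * s"] by (simp add: power2_eq_square algebra_simps)
    have "(norm (A *v x))\<^sup>2 = (A$1$1 * x$1 + A$1$2 * x$2)\<^sup>2 + (A$2$1 * x$1 + A$2$2 * x$2)\<^sup>2"
      by (simp add: norm_eq_sqrt_inner inner_vec_def sum_2 matrix_vector_mult_def power2_eq_square)
    also have "\<dots> \<le> frobenius_sq A * ((x$1)\<^sup>2 + (x$2)\<^sup>2)"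
      using cs[of "A$1$1" "x$1" "A$1$2" "x$2"] cs[of "A$2$1" "x$1" "A$2$2" "x$2"]
      by (simp add: frobenius_sq_def algebra_simps)
    also have "(x$1)\<^sup>2 + (x$2)\<^sup>2 = (norm x)\<^sup>2"
      by (simp add: norm_eq_sqrt_inner inner_vec_def sum_2 power2_eq_square)
    also have "frobenius_sq A * (norm x)\<^sup>2 = (sqrt (frobenius_sq A) * norm x)\<^sup>2"
      by (simp add: power_mult_distrib frobenius_sq_def)
    finally show "(norm (A *v x))\<^sup>2 \<le> (sqrt (frobenius_sq A) * norm x)\<^sup>2" .
  qed (simp add: frobenius_sq_def)
  then have "onorm ((*v) A) \<le> sqrt (frobenius_sq A)" by (rule onorm_le)
  moreover have "0 \<le> onorm ((*v) A)" by (rule onorm_pos_le) (rule matrix_vector_mul_bounded_linear)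
  ultimately have "(onorm ((*v) A))\<^sup>2 \<le> (sqrt (frobenius_sq A))\<^sup>2" by (rule power_mono)
  then show ?thesis by (simp add: frobenius_sq_def)
qed

text \<open>The formal derivative has to be a measurable function defined everywhere, so it is taken
as the limit of the difference quotients along the coordinate axes; \<open>lim\<close> is a measurable operation also where the
sequence diverges.\<close>

lemma K_quasiregular_of_lipschitz:
  fixes f :: "plane \<Rightarrow> plane"
  assumes K: "K \<ge> 1"
    and lip: "\<And>r. \<exists>L. L-lipschitz_on (cball 0 r) f"
    and deriv: "AE x in lborel. \<exists>A. (f has_derivative (*v) A) (at x) \<and> frobenius_sq A \<le> K * det A"
  shows "K_quasiregular K UNIV f"
proof -
  define q where "q n i j x = real (Suc n) * (f (x + (1 / real (Suc n)) *\<^sub>R axis j 1) $ i - f x $ i)"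
    for n and i j :: 2 and x
  define D :: "plane \<Rightarrow> real^2^2" where "D x = (\<chi> i j. lim (\<lambda>n. q n i j x))" for x
  have fc: "continuous_on UNIV f" by (rule continuous_on_of_lipschitz_on_balls[OF lip])
  have lipi: "\<exists>L. L-lipschitz_on (cball 0 r) (\<lambda>x. f x $ i)" for r i
  proof -
    obtain L where L: "L-lipschitz_on (cball 0 r) f" using lip by blast
    have "L-lipschitz_on (cball 0 r) (\<lambda>x. f x $ i)"
    proof (rule lipschitz_onI)
      show "dist (f x $ i) (f y $ i) \<le> L * dist x y" if "x \<in> cball 0 r" "y \<in> cball 0 r" for x y
        using dist_vec_nth_le[of "f x" i "f y"] lipschitz_onD[OF L that] by linarith
    qed (rule lipschitz_on_nonneg[OF L])
    then show ?thesis by blast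
  qed
  have fic: "continuous_on UNIV (\<lambda>x. f x $ i)" for i by (intro continuous_intros fc)
  then have fim[measurable]: "(\<lambda>x. f x $ i) \<in> borel_measurable borel" for i
    by (rule borel_measurable_continuous_onI)
  have qc: "continuous_on UNIV (\<lambda>x. q n i j x)" for n i j
    unfolding q_def by (intro continuous_intros continuous_on_compose2[OF fic]) auto
  have qm[measurable]: "(\<lambda>x. q n i j x) \<in> borel_measurable borel" for n i j
    by (rule borel_measurable_continuous_onI[OF qc])
  have Dm[measurable]: "(\<lambda>x. D x $ i $ j) \<in> borel_measurable borel" for i j
    unfolding D_def by simp
  have comp: "((\<lambda>x. f x $ i) has_derivative (\<lambda>h. (A *v h) $ i)) (at x)"
    if "(f has_derivative (*v) A) (at x)" for A x i
    by (rule bounded_linear.has_derivative[OF bounded_linear_vec_nth that])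
  have ax: "(A *v axis j 1) $ i = A $ i $ j" for A :: "real^2^2" and i j
    by (simp add: matrix_vector_mult_basis column_def)
  have lim: "(\<lambda>n. q n i j x) \<longlonglongrightarrow> A $ i $ j" if "(f has_derivative (*v) A) (at x)" for A x i j
    using difference_quotient_LIMSEQ[OF comp[OF that], of "axis j 1" i] unfolding q_def ax by simp
  have DA: "D x = A" if "(f has_derivative (*v) A) (at x)" for A x
    using limI[OF lim[OF that]] by (simp add: D_def vec_eq_iff)
  have Db: "\<exists>B. AE x in lborel. norm x \<le> r \<longrightarrow> \<bar>D x $ i $ j\<bar> \<le> B" for r i j
  proof -
    obtain L where L: "L-lipschitz_on (cball 0 (r+1)) f" using lip by blast
    have qb: "\<bar>q n i j x\<bar> \<le> L" if "norm x \<le> r" for n x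
    proof -
      have 1: "norm ((1 / real (Suc n)) *\<^sub>R axis j 1 :: plane) = 1 / real (Suc n)"
        by simp
      then have 2: "norm (x + (1 / real (Suc n)) *\<^sub>R axis j 1) \<le> r + 1"
        using norm_triangle_ineq[of x "(1 / real (Suc n)) *\<^sub>R axis j 1"] that
        by (smt (verit) divide_le_eq_1 of_nat_0_less_iff of_nat_Suc of_nat_0_le_iff)
      have "\<bar>f (x + (1 / real (Suc n)) *\<^sub>R axis j 1) $ i - f x $ i\<bar>
          \<le> norm (f (x + (1 / real (Suc n)) *\<^sub>R axis j 1) - f x)"
        by (metis component_le_norm_cart vector_minus_component)
      also have "\<dots> \<le> L * norm ((1 / real (Suc n)) *\<^sub>R axis j 1 :: plane)"
        using lipschitz_onD[OF L, of "x + (1 / real (Suc n)) *\<^sub>R axis j 1" x, unfolded mem_cball_0] 2 that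
        by (simp add: dist_norm)
      also have "\<dots> = L * (1 / real (Suc n))" using 1 by simp
      finally have "real (Suc n) * \<bar>f (x + (1 / real (Suc n)) *\<^sub>R axis j 1) $ i - f x $ i\<bar>
          \<le> real (Suc n) * (L * (1 / real (Suc n)))"
        by (rule mult_left_mono) simp
      then show ?thesis by (simp only: q_def abs_mult abs_of_nat) simp
    qed
    have "AE x in lborel. norm x \<le> r \<longrightarrow> \<bar>D x $ i $ j\<bar> \<le> L"
      using deriv
    proof eventually_elim
      case (elim x)
      then obtain A where A: "(f has_derivative (*v) A) (at x)" by blast
      have "\<bar>A $ i $ j\<bar> \<le> L" if "norm x \<le> r"
        using LIMSEQ_le_const2[OF tendsto_rabs[OF lim[OF A]]] qb[OF that] by blast
      then show ?case using DA[OF A] by simp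
    qed
    then show ?thesis by blast
  qed
  have fb: "\<exists>B. AE x in lborel. norm x \<le> r \<longrightarrow> \<bar>f x $ i\<bar> \<le> B" for r i
  proof -
    have "bounded ((\<lambda>x. f x $ i) ` cball 0 r)"
      by (intro compact_imp_bounded compact_continuous_image continuous_on_subset[OF fic]) auto
    then obtain B where "\<forall>x\<in>cball 0 r. \<bar>f x $ i\<bar> \<le> B" by (auto simp: bounded_iff)
    then show ?thesis by (intro exI[of _ B] AE_I2) auto
  qed
  have W: "W12_loc_deriv UNIV f D"
    unfolding W12_loc_deriv_def
  proof (intro conjI allI)
    fix i j
    show "locally_L2 UNIV (\<lambda>x. f x $ i)" by (rule locally_L2_of_locally_bounded[OF fim fb])
    show "locally_L2 UNIV (\<lambda>x. D x $ i $ j)" by (rule locally_L2_of_locally_bounded[OF Dm Db])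
    show "weak_partial UNIV j (\<lambda>x. f x $ i) (\<lambda>x. D x $ i $ j)"
    proof (rule weak_partial_of_lipschitz[OF lipi Dm])
      show "AE x in lborel. \<exists>Da. ((\<lambda>x. f x $ i) has_derivative Da) (at x) \<and> Da (axis j 1) = D x $ i $ j"
        using deriv
      proof eventually_elim
        case (elim x)
        then obtain A where A: "(f has_derivative (*v) A) (at x)" by blast
        show ?case using comp[OF A] ax DA[OF A] by blast
      qed
    qed
  qed
  have "AE x in lborel. (onorm ((*v) (D x)))\<^sup>2 \<le> K * det (D x)"
    using deriv
  proof eventually_elim
    case (elim x)
    then obtain A where A: "(f has_derivative (*v) A) (at x)" "frobenius_sq A \<le> K * det A" by blast
    show ?case unfolding DA[OF A(1)] using onorm_sq_le_frobenius[of A] A(2) by linarith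
  qed
  then have "AE x\<in>UNIV in lebesgue. (onorm ((*v) (D x)))\<^sup>2 \<le> K * det (D x)"
    by (auto dest: AE_completion)
  then show ?thesis unfolding K_quasiregular_def using K W fc by auto
qed

section \<open>Coordinates\<close>

definition pt :: "real \<Rightarrow> real \<Rightarrow> plane" where
  "pt a b = (\<chi> i. if i = 1 then a else b)"

lemma pt_simps [simp]: "pt a b $ 1 = a" "pt a b $ 2 = b"
  by (simp_all add: pt_def)

lemma plane_eq_iff: "(v::plane) = w \<longleftrightarrow> v $ 1 = w $ 1 \<and> v $ 2 = w $ 2"
  by (simp add: vec_eq_iff forall_2)

lemma norm_plane_sq: "(norm (v::plane))\<^sup>2 = (v$1)\<^sup>2 + (v$2)\<^sup>2"
  by (simp add: norm_eq_sqrt_inner inner_vec_def sum_2 power2_eq_square)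

lemma norm_plane_le: "norm (v::plane) \<le> \<bar>v$1\<bar> + \<bar>v$2\<bar>"
  using norm_le_l1_cart[of v] by (simp add: sum_2)

definition to_cx :: "plane \<Rightarrow> complex" where
  "to_cx v = Complex (v$1) (v$2)"

lemma to_cx_simps [simp]: "Re (to_cx v) = v$1" "Im (to_cx v) = v$2"
  by (simp_all add: to_cx_def)

lemma norm_to_cx [simp]: "norm (to_cx v) = norm v"
proof (rule power2_eq_imp_eq)
  show "(norm (to_cx v))\<^sup>2 = (norm v)\<^sup>2"
    by (simp add: norm_plane_sq cmod_power2)
qed auto

lemma bounded_linear_to_cx: "bounded_linear to_cx"
  by (rule bounded_linear_intro[of _ 1]) (auto simp: complex_eq_iff)

lemma to_cx_diff: "to_cx v - to_cx w = to_cx (v - w)"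
  by (simp add: complex_eq_iff)

lemma surj_to_cx: "surj to_cx"
  by (rule surjI[of _ "\<lambda>z. pt (Re z) (Im z)"]) (simp add: complex_eq_iff)

lemma pt_eq: "pt a b = a *\<^sub>R pt 1 0 + b *\<^sub>R pt 0 1"
  by (simp add: plane_eq_iff)

lemma has_derivative_pt:
  assumes "(f has_derivative f') F" "(g has_derivative g') F"
  shows "((\<lambda>x. pt (f x) (g x)) has_derivative (\<lambda>h. pt (f' h) (g' h))) F"
  unfolding pt_eq[of "f _"] pt_eq[of "f' _"]
  by (intro derivative_intros assms)

lemma axis_pt: "axis 1 1 = pt 1 0" "axis 2 1 = pt 0 1"
  by (auto simp: plane_eq_iff axis_def)

section \<open>The map\<close>

text \<open>Half the thickness of the chain of beads at abscissa \<open>x\<close>. Halving \<open>x\<close> only changes the sign of the sine,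
so that the squared sine makes the profile self-similar; its zeros separate the beads. The factor
\<open>1/100\<close> keeps the slope, and with it the shear of the map, small.\<close>

definition bead_height :: "real \<Rightarrow> real" where
  "bead_height x = (if 0 < x \<and> x < 1 then x * (sin (pi * log 2 x))\<^sup>2 / 100 else 0)"

text \<open>As a function of \<open>y\<close>, an odd function: the identity up to height \<open>b\<close>, then descending to 0 at
height \<open>2 b\<close>, and 0 from there on. Subtracting \<open>3/4\<close> of it from \<open>5/4 y\<close> leaves \<open>y / 2\<close> inside a bead.
The descent keeps the modification inside a compact set, away from the critical points of the polynomial.\<close>

definition tent :: "real \<Rightarrow> real \<Rightarrow> real" where
  "tent b y = max 0 (min y (2 * b - y)) - max 0 (min (- y) (2 * b + y))"

definition cutoff :: "real \<Rightarrow> real" where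
  "cutoff t = max 0 (min 1 ((t - 2) / 2))"

text \<open>The coefficient \<open>1 / 40000 = 1 / (4 * 10^4)\<close> puts the nonzero roots of \<open>z + z ^ 5 / 40000\<close> at \<open>\<plusminus> 10 \<plusminus> 10 \<i>\<close>.\<close>

definition perturb :: "complex \<Rightarrow> complex" where
  "perturb z = z + of_real (cutoff ((norm z)\<^sup>2) / 40000) * z ^ 5"

definition stretch :: "complex \<Rightarrow> plane" where
  "stretch z = pt (Re z / 2) (5/4 * Im z)"

definition wander :: "plane \<Rightarrow> plane" where
  "wander v = stretch (perturb (to_cx v)) - pt 0 (3/4 * tent (bead_height (v$1)) (v$2))"

lemma wander_nth:
  "wander v $ 1 = Re (perturb (to_cx v)) / 2"
  "wander v $ 2 = 5/4 * Im (perturb (to_cx v)) - 3/4 * tent (bead_height (v$1)) (v$2)"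
  by (simp_all add: wander_def stretch_def)

lemma tent_inside: "\<bar>y\<bar> \<le> b \<Longrightarrow> tent b y = y"
  by (auto simp: tent_def max_def min_def)

lemma tent_outside: "2 * b \<le> \<bar>y\<bar> \<Longrightarrow> tent b y = 0"
  by (auto simp: tent_def max_def min_def)

lemma tent_between: "b \<le> \<bar>y\<bar> \<Longrightarrow> \<bar>y\<bar> \<le> 2 * b \<Longrightarrow> tent b y = 2 * b * sgn y - y"
  by (auto simp: tent_def max_def min_def sgn_if)

lemma tent_minus: "tent b (- y) = - tent b y"
  by (simp add: tent_def)

lemma tent_lipschitz: "\<bar>tent b y - tent b' y'\<bar> \<le> 4 * \<bar>b - b'\<bar> + 4 * \<bar>y - y'\<bar>"
proof -
  have max: "\<bar>max 0 p - max 0 q\<bar> \<le> \<bar>p - q\<bar>" for p q :: real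
    by (auto simp: max_def)
  have min: "\<bar>min s t - min s' t'\<bar> \<le> \<bar>s - s'\<bar> + \<bar>t - t'\<bar>" for s t s' t' :: real
    by (auto simp: min_def)
  have *: "\<bar>max 0 (min s t) - max 0 (min s' t')\<bar> \<le> \<bar>s - s'\<bar> + \<bar>t - t'\<bar>" for s t s' t' :: real
    by (rule order_trans[OF max min])
  have 1: "\<bar>(2 * b - y) - (2 * b' - y')\<bar> \<le> 2 * \<bar>b - b'\<bar> + \<bar>y - y'\<bar>"
  proof -
    have "(2 * b - y) - (2 * b' - y') = 2 * (b - b') - (y - y')" by simp
    then show ?thesis
      by (simp only: order_trans[OF abs_triangle_ineq4] abs_mult abs_numeral order_refl)
  qed
  have 2: "\<bar>(2 * b + y) - (2 * b' + y')\<bar> \<le> 2 * \<bar>b - b'\<bar> + \<bar>y - y'\<bar>"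
  proof -
    have "(2 * b + y) - (2 * b' + y') = 2 * (b - b') + (y - y')" by simp
    then show ?thesis
      by (simp only: order_trans[OF abs_triangle_ineq] abs_mult abs_numeral order_refl)
  qed
  have 3: "\<bar>- y - - y'\<bar> = \<bar>y - y'\<bar>" by simp
  have "\<bar>tent b y - tent b' y'\<bar> \<le> \<bar>max 0 (min y (2 * b - y)) - max 0 (min y' (2 * b' - y'))\<bar>
      + \<bar>max 0 (min (- y) (2 * b + y)) - max 0 (min (- y') (2 * b' + y'))\<bar>"
    unfolding tent_def by (rule order_trans[OF _ abs_triangle_ineq4]) (simp add: algebra_simps)
  also have "\<dots> \<le> (\<bar>y - y'\<bar> + (2 * \<bar>b - b'\<bar> + \<bar>y - y'\<bar>)) + (\<bar>- y - - y'\<bar> + (2 * \<bar>b - b'\<bar> + \<bar>y - y'\<bar>))"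
    by (rule add_mono[OF order_trans[OF * add_mono[OF order_refl 1]]
          order_trans[OF * add_mono[OF order_refl 2]]])
  finally show ?thesis unfolding 3 by simp
qed

text \<open>Together with \<open>3/4 < 5/4\<close> this makes the vertical coordinate of the map strictly increasing along vertical lines.\<close>

lemma tent_difference_le:
  assumes "0 \<le> b" "y < y'"
  shows "tent b y' - tent b y \<le> y' - y"
proof -
  have pos: "tent b t = max 0 (min t (2 * b - t))" if "0 \<le> t" for t
    using that assms(1) by (auto simp: tent_def max_def)
  have 1: "tent b t' - tent b t \<le> t' - t" if "0 \<le> t" "t < t'" for t t'
    using that assms(1) by (auto simp: pos max_def min_def)
  show ?thesis
  proof (cases "0 \<le> y \<or> y' \<le> 0")
    case True
    then show ?thesis using 1[of y y'] 1[of "- y'" "- y"] assms(2) tent_minus by auto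
  next
    case False
    then have "tent b y' \<le> y'" "tent b (- y) \<le> - y" by (auto simp: pos max_def)
    then show ?thesis by (simp add: tent_minus)
  qed
qed

text \<open>The expansion off the chain. Above height \<open>b\<close> the tent stays below \<open>b\<close>, so \<open>5/4 y\<close> loses at most
\<open>3/4 b\<close>, which still leaves \<open>b / 2\<close> plus \<open>5/4\<close> of the excess \<open>\<bar>y\<bar> - b\<close>.\<close>

lemma tent_excess:
  assumes "0 \<le> b" "b < \<bar>y\<bar>"
  shows "\<bar>5/4 * y - 3/4 * tent b y\<bar> \<ge> b / 2 + 5/4 * (\<bar>y\<bar> - b)"
    and "\<bar>5/4 * y - 3/4 * tent b y\<bar> \<le> 5/4 * \<bar>y\<bar>"
proof -
  have *: "b / 2 + 5/4 * (t - b) \<le> 5/4 * t - 3/4 * tent b t \<and> 5/4 * t - 3/4 * tent b t \<le> 5/4 * t"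
    if "b < t" for t
  proof (cases "2 * b \<le> t")
    case True
    then have "tent b t = 0" using tent_outside assms(1) by simp
    then show ?thesis using assms(1) by (simp add: field_simps)
  next
    case False
    then have "tent b t = 2 * b - t" using tent_between[of b t] that assms(1) by simp
    then show ?thesis using False that by (simp add: field_simps)
  qed
  have h: "5/4 * t - 3/4 * tent b t \<ge> 0" if "b < t" for t
  proof -
    have "0 \<le> b / 2 + 5/4 * (t - b)" using that assms(1) by simp
    then show ?thesis using *[OF that] by linarith
  qed
  have "b / 2 + 5/4 * (\<bar>y\<bar> - b) \<le> \<bar>5/4 * y - 3/4 * tent b y\<bar> \<and>
    \<bar>5/4 * y - 3/4 * tent b y\<bar> \<le> 5/4 * \<bar>y\<bar>"
  proof (cases "0 \<le> y")
    case True
    then show ?thesis using *[of y] h[of y] assms(2) by simp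
  next
    case False
    then have "\<bar>5/4 * y - 3/4 * tent b y\<bar> = 5/4 * (- y) - 3/4 * tent b (- y)"
      using h[of "- y"] assms(2) by (simp add: tent_minus)
    then show ?thesis using *[of "- y"] False assms(2) by simp
  qed
  then show "b / 2 + 5/4 * (\<bar>y\<bar> - b) \<le> \<bar>5/4 * y - 3/4 * tent b y\<bar>"
    and "\<bar>5/4 * y - 3/4 * tent b y\<bar> \<le> 5/4 * \<bar>y\<bar>" by auto
qed

lemma bead_height_nonneg: "0 \<le> bead_height x"
  by (simp add: bead_height_def)

lemma bead_height_le: "0 < x \<Longrightarrow> bead_height x \<le> x / 100"
proof -
  assume "0 < x"
  moreover have "x * (sin (pi * log 2 x))\<^sup>2 \<le> x * 1"
    using \<open>0 < x\<close> abs_sin_le_one by (intro mult_left_mono) (auto simp: abs_square_le_1)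
  ultimately show ?thesis by (simp add: bead_height_def)
qed

lemma bead_height_bound: "bead_height x \<le> 1 / 100"
proof (cases "0 < x \<and> x < 1")
  case True
  then show ?thesis using bead_height_le[of x] by simp
qed (auto simp: bead_height_def)

lemma bead_height_half:
  assumes "x < 1"
  shows "bead_height (x / 2) = bead_height x / 2"
proof (cases "0 < x")
  case True
  have "log 2 (x / 2) = log 2 x - 1" using True by (simp add: log_divide)
  then have "sin (pi * log 2 (x / 2)) = - sin (pi * log 2 x)"
    by (simp add: right_diff_distrib sin_diff)
  then show ?thesis using True assms by (simp add: bead_height_def)
qed (simp add: bead_height_def)

lemma bead_height_dyadic: "bead_height ((1/2) ^ n) = 0"
proof -
  have "log 2 ((1/2) ^ n) = - real n"
    by (simp add: log_nat_power log_divide)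
  then show ?thesis by (simp add: bead_height_def)
qed

lemma bead_height_pos:
  assumes "(1/2) ^ Suc n < x" "x < (1/2) ^ n"
  shows "0 < bead_height x"
proof -
  have x: "0 < x" "x < 1"
    using assms by (auto intro: less_trans[OF zero_less_power] less_le_trans[OF _ power_le_one])
  have "log 2 ((1/2) ^ Suc n) < log 2 x" "log 2 x < log 2 ((1/2) ^ n)"
    using assms x by (subst log_less_cancel_iff; simp)+
  then have l: "- real n - 1 < log 2 x" "log 2 x < - real n"
    using log_nat_power[of "1/2" 2 "Suc n"] log_nat_power[of "1/2" 2 n] by (simp_all add: log_divide)
  have "sin (pi * log 2 x) \<noteq> 0"
  proof
    assume "sin (pi * log 2 x) = 0"
    then obtain i :: int where "pi * log 2 x = of_int i * pi"
      unfolding sin_zero_iff_int2 by blast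
    then have "log 2 x = of_int i" by simp
    then have "- int n - 1 < i" "i < - int n" using l by linarith+
    then show False by linarith
  qed
  then show ?thesis using x by (simp add: bead_height_def)
qed

text \<open>Stated for the formula on the whole half-line, so that the mean value theorem can be used up to the endpoint
\<open>x = 1\<close>, where the formula vanishes.\<close>

lemma bead_height_formula_deriv:
  assumes "0 < x"
  obtains d where "((\<lambda>x. x * (sin (pi * log 2 x))\<^sup>2 / 100) has_real_derivative d) (at x)" "\<bar>d\<bar> \<le> 17/100"
proof
  define s c where "s = sin (pi * log 2 x)" and "c = cos (pi * log 2 x)"
  show "((\<lambda>x. x * (sin (pi * log 2 x))\<^sup>2 / 100) has_real_derivative
      (s\<^sup>2 + 2 * s * c * (pi / ln 2)) / 100) (at x)"
    using assms unfolding s_def c_def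
    by (auto intro!: derivative_eq_intros simp: log_def field_simps power2_eq_square)
  have s: "\<bar>s\<bar> \<le> 1" "\<bar>c\<bar> \<le> 1" by (auto simp: s_def c_def)
  have "pi / ln 2 \<le> 8"
    using ln2_ge_two_thirds pi_less_4 by (simp add: field_simps)
  moreover have "0 \<le> pi / ln 2" by simp
  moreover have "\<bar>s * c\<bar> \<le> 1" using s by (simp add: abs_mult mult_le_one)
  ultimately have "\<bar>s * c * (pi / ln 2)\<bar> \<le> 1 * 8"
    unfolding abs_mult[of "s * c"] by (intro mult_mono) auto
  then have "- 8 \<le> s * c * (pi / ln 2)" "s * c * (pi / ln 2) \<le> 8" by linarith+
  moreover have "0 \<le> s\<^sup>2" "s\<^sup>2 \<le> 1" using s by (simp_all add: abs_square_le_1)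
  moreover have "2 * s * c * (pi / ln 2) = 2 * (s * c * (pi / ln 2))" by (simp add: mult.assoc)
  ultimately have "\<bar>s\<^sup>2 + 2 * s * c * (pi / ln 2)\<bar> \<le> 17" by (smt (verit))
  then show "\<bar>(s\<^sup>2 + 2 * s * c * (pi / ln 2)) / 100\<bar> \<le> 17/100" by simp
qed

lemma bead_height_deriv:
  assumes "0 < x" "x < 1"
  obtains d where "(bead_height has_real_derivative d) (at x)" "\<bar>d\<bar> \<le> 17/100"
proof -
  obtain d where d: "((\<lambda>x. x * (sin (pi * log 2 x))\<^sup>2 / 100) has_real_derivative d) (at x)"
    "\<bar>d\<bar> \<le> 17/100" using bead_height_formula_deriv assms by blast
  have "(bead_height has_real_derivative d) (at x)"
    by (rule has_field_derivative_transform_within_open[OF d(1), of "{0<..<1}"])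
      (use assms in \<open>auto simp: bead_height_def\<close>)
  then show ?thesis using d(2) that by blast
qed

lemma bead_height_lipschitz: "\<bar>bead_height x - bead_height y\<bar> \<le> \<bar>x - y\<bar>"
proof -
  define F :: "real \<Rightarrow> real" where "F x = x * (sin (pi * log 2 x))\<^sup>2 / 100" for x
  have F: "\<bar>F x - F y\<bar> \<le> \<bar>x - y\<bar>" if xy: "0 < x" "x < y" for x y
  proof -
    have "norm (F y - F x) \<le> 1 * norm (y - x)"
    proof (rule differentiable_bound[of "{x..y}" F "\<lambda>z h. deriv F z * h"])
      fix z assume "z \<in> {x..y}"
      then obtain d where d: "(F has_real_derivative d) (at z)" "\<bar>d\<bar> \<le> 17/100"
        using bead_height_formula_deriv[of z] xy(1) unfolding F_def by force
      then have dd: "deriv F z = d" by (blast intro: DERIV_imp_deriv)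
      show "(F has_derivative (*) (deriv F z)) (at z within {x..y})"
        using d(1) unfolding dd has_field_derivative_def by (rule has_derivative_at_withinI)
      show "onorm ((*) (deriv F z)) \<le> 1"
      proof (rule onorm_le)
        show "norm (deriv F z * h) \<le> 1 * norm h" for h
          unfolding dd norm_mult using d(2) by (intro mult_right_mono) auto
      qed
    qed (use xy in auto)
    then show ?thesis by (simp add: abs_minus_commute)
  qed
  have F1: "F 1 = 0" by (simp add: F_def)
  have *: "\<bar>bead_height x - bead_height y\<bar> \<le> \<bar>x - y\<bar>" if "x < y" for x y
  proof -
    have bF: "bead_height z = F z" if "0 < z" "z < 1" for z
      using that by (simp add: bead_height_def F_def)
    consider "x \<le> 0" "y \<le> 0 \<or> y \<ge> 1" | "x \<le> 0" "0 < y" "y < 1" | "0 < x" "y < 1"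
      | "0 < x" "x < 1" "y \<ge> 1" | "x \<ge> 1" using \<open>x < y\<close> by linarith
    then show ?thesis
    proof cases
      case 2
      then have "bead_height x = 0" by (simp add: bead_height_def)
      then show ?thesis using bead_height_le[of y] bead_height_nonneg[of y] 2 by (simp add: abs_if)
    next
      case 3 then show ?thesis using F[of x y] bF[of x] bF[of y] that by simp
    next
      case 4
      then have "bead_height y = 0" by (simp add: bead_height_def)
      then show ?thesis using F[of x 1] F1 bF[of x] 4 by simp
    qed (use that in \<open>auto simp: bead_height_def\<close>)
  qed
  show ?thesis using *[of x y] *[of y x] by (cases x y rule: linorder_cases) (auto simp: abs_minus_commute)
qed

lemma continuous_on_bead_height: "continuous_on S bead_height"
proof -
  have "1-lipschitz_on S bead_height"
    by (rule lipschitz_onI) (use bead_height_lipschitz in \<open>auto simp: dist_real_def\<close>)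
  then show ?thesis by (rule lipschitz_on_continuous_on)
qed

text \<open>The modification lives where \<open>\<bar>v\<bar> < 6/5\<close>, well inside the disc on which \<open>perturb\<close> is the identity.\<close>

lemma tent_bead_support:
  assumes "(norm (v::plane))\<^sup>2 \<ge> 36/25"
  shows "2 * bead_height (v$1) \<le> \<bar>v$2\<bar>"
proof (rule ccontr)
  assume a: "\<not> 2 * bead_height (v$1) \<le> \<bar>v$2\<bar>"
  then have "bead_height (v$1) \<noteq> 0" by auto
  then have x: "0 < v$1" "v$1 < 1" unfolding bead_height_def by (auto split: if_splits)
  have "\<bar>v$2\<bar> \<le> 1/50" using a bead_height_bound[of "v$1"] by linarith
  then have "(v$2)\<^sup>2 \<le> (1/50)\<^sup>2" using abs_le_square_iff[of "v$2" "1/50"] by simp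
  moreover have "(v$1)\<^sup>2 \<le> 1" using x by (simp add: power_le_one)
  ultimately show False using assms unfolding norm_plane_sq by (simp add: power2_eq_square)
qed

lemma perturb_near: "(norm z)\<^sup>2 \<le> 2 \<Longrightarrow> perturb z = z"
  by (simp add: perturb_def cutoff_def)

lemma perturb_far: "(norm z)\<^sup>2 \<ge> 4 \<Longrightarrow> perturb z = z + z ^ 5 / 40000"
  by (simp add: perturb_def cutoff_def)

lemma cutoff_bounds: "0 \<le> cutoff t" "cutoff t \<le> 1"
  by (auto simp: cutoff_def)

lemma cutoff_lipschitz: "\<bar>cutoff s - cutoff t\<bar> \<le> \<bar>s - t\<bar> / 2"
  by (auto simp: cutoff_def max_def min_def abs_if field_simps)

text \<open>For \<open>r = 3\<close> the constant is below 1, so that \<open>perturb\<close>, a perturbation of the identity, is injective on the disc of radius 3.\<close>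

lemma perturb_lipschitz:
  assumes z: "norm z \<le> r" and w: "norm w \<le> r"
  shows "norm ((perturb z - z) - (perturb w - w)) \<le> (5 * r ^ 4 + r ^ 6) / 40000 * norm (z - w)"
proof -
  define a b where "a = cutoff ((norm z)\<^sup>2)" and "b = cutoff ((norm w)\<^sup>2)"
  have r0: "0 \<le> r" using z norm_ge_zero order_trans by blast
  have "z^5 - w^5 = (z - w) * (z^4 + z^3*w + z\<^sup>2*w\<^sup>2 + z*w^3 + w^4)"
    by algebra
  then have "norm (z^5 - w^5) = norm (z - w) * norm (z^4 + z^3*w + z\<^sup>2*w\<^sup>2 + z*w^3 + w^4)"
    by (simp add: norm_mult)
  also have "\<dots> \<le> norm (z - w) * (5 * r^4)"
  proof (rule mult_left_mono)
    have p: "norm (z^i * w^j) \<le> r ^ (i + j)" for i j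
      unfolding norm_mult norm_power power_add
      using z w r0 by (intro mult_mono power_mono) auto
    have "norm (z^4 + z^3*w + z\<^sup>2*w\<^sup>2 + z*w^3 + w^4) \<le> r^4 + r^4 + r^4 + r^4 + r^4"
      using p[of 4 0] p[of 3 1] p[of 2 2] p[of 1 3] p[of 0 4]
      by (intro norm_triangle_mono) simp_all
    then show "norm (z^4 + z^3*w + z\<^sup>2*w\<^sup>2 + z*w^3 + w^4) \<le> 5 * r^4" by simp
  qed simp
  finally have 1: "norm (z^5 - w^5) \<le> norm (z - w) * (5 * r^4)" .
  have "(norm z)\<^sup>2 - (norm w)\<^sup>2 = (norm z - norm w) * (norm z + norm w)"
    by (simp add: power2_eq_square algebra_simps)
  then have "\<bar>(norm z)\<^sup>2 - (norm w)\<^sup>2\<bar> = \<bar>norm z - norm w\<bar> * (norm z + norm w)"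
    by (simp add: abs_mult)
  also have "\<dots> \<le> norm (z - w) * (2 * r)"
    using z w by (intro mult_mono norm_triangle_ineq3) auto
  finally have 2: "\<bar>a - b\<bar> \<le> r * norm (z - w)"
    using cutoff_lipschitz[of "(norm z)\<^sup>2" "(norm w)\<^sup>2"] unfolding a_def b_def
    by (simp add: mult.commute mult.left_commute)
  have "norm (of_real a * z^5 - of_real b * w^5) = norm (of_real a * (z^5 - w^5) + of_real (a - b) * w^5)"
    by (simp add: algebra_simps)
  also have "\<dots> \<le> \<bar>a\<bar> * norm (z^5 - w^5) + \<bar>a - b\<bar> * norm w ^ 5"
    by (rule order_trans[OF norm_triangle_ineq]) (simp add: norm_mult norm_power flip: of_real_diff)
  also have "\<dots> \<le> 1 * (norm (z - w) * (5 * r^4)) + (r * norm (z - w)) * r ^ 5"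
    using 1 2 w r0 cutoff_bounds[of "(norm z)\<^sup>2"]
    by (intro add_mono mult_mono power_mono) (auto simp: a_def)
  also have "\<dots> = (5 * r ^ 4 + r ^ 6) * norm (z - w)"
    by (simp add: algebra_simps eval_nat_numeral)
  finally have 3: "norm (of_real a * z^5 - of_real b * w^5) \<le> (5 * r ^ 4 + r ^ 6) * norm (z - w)" .
  have eq: "(perturb z - z) - (perturb w - w) = (of_real a * z^5 - of_real b * w^5) / 40000"
    by (simp add: perturb_def a_def b_def algebra_simps diff_divide_distrib)
  show ?thesis unfolding eq norm_divide using 3 by (simp add: field_simps)
qed

lemma wander_lipschitz: "\<exists>L. L-lipschitz_on (cball 0 r) wander"
proof -
  define C where "C = (5 * r ^ 4 + r ^ 6) / 40000"
  have C0: "C \<ge> 0" unfolding C_def by (simp add: zero_le_even_power)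
  have "(2 * (1 + C) + 6)-lipschitz_on (cball 0 r) wander"
  proof (rule lipschitz_onI)
    fix v w :: plane assume vw: "v \<in> cball 0 r" "w \<in> cball 0 r"
    define z where "z = perturb (to_cx v) - perturb (to_cx w)"
    have "z = to_cx (v - w) + ((perturb (to_cx v) - to_cx v) - (perturb (to_cx w) - to_cx w))"
      by (simp add: z_def flip: to_cx_diff)
    then have "norm z \<le> norm (v - w) + C * norm (v - w)"
      using perturb_lipschitz[of "to_cx v" r "to_cx w"] vw
      unfolding C_def to_cx_diff by (simp add: norm_triangle_le)
    then have z: "\<bar>Re z\<bar> \<le> (1 + C) * norm (v - w)" "\<bar>Im z\<bar> \<le> (1 + C) * norm (v - w)"
      using abs_Re_le_cmod[of z] abs_Im_le_cmod[of z] by (auto simp: algebra_simps)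
    define t where "t = tent (bead_height (v$1)) (v$2) - tent (bead_height (w$1)) (w$2)"
    have "\<bar>t\<bar> \<le> 4 * \<bar>v$1 - w$1\<bar> + 4 * \<bar>v$2 - w$2\<bar>"
      unfolding t_def
      by (rule order_trans[OF tent_lipschitz]) (use bead_height_lipschitz[of "v$1" "w$1"] in simp)
    moreover have "\<bar>v$1 - w$1\<bar> \<le> norm (v - w)" "\<bar>v$2 - w$2\<bar> \<le> norm (v - w)"
      using component_le_norm_cart[of "v - w"] by (metis vector_minus_component)+
    ultimately have t: "\<bar>t\<bar> \<le> 8 * norm (v - w)"
      by (simp add: order_trans[OF _ add_mono[of "4 * _" "4 * _" "4 * _" "4 * _"]])
    have "norm (wander v - wander w) \<le> \<bar>(wander v - wander w)$1\<bar> + \<bar>(wander v - wander w)$2\<bar>"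
      by (rule norm_plane_le)
    also have "(wander v - wander w)$1 = Re z / 2" by (simp add: wander_nth z_def diff_divide_distrib)
    also have "(wander v - wander w)$2 = 5/4 * Im z - 3/4 * t"
      by (simp add: wander_nth z_def t_def field_simps)
    also have "\<bar>Re z / 2\<bar> + \<bar>5/4 * Im z - 3/4 * t\<bar> \<le> 2 * ((1 + C) * norm (v - w)) + 6 * norm (v - w)"
      using z t by linarith
    finally show "dist (wander v) (wander w) \<le> (2 * (1 + C) + 6) * dist v w"
      by (simp add: dist_norm algebra_simps)
  qed (use C0 in simp)
  then show ?thesis by blast
qed

lemma continuous_on_wander: "continuous_on S wander"
  using continuous_on_of_lipschitz_on_balls[OF wander_lipschitz] continuous_on_subset by blast

section \<open>Openness\<close>

lemma bounded_linear_stretch: "bounded_linear stretch"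
proof (rule bounded_linear_intro[of _ 2])
  fix z
  have "norm (stretch z) \<le> \<bar>Re z / 2\<bar> + \<bar>5/4 * Im z\<bar>"
    using norm_plane_le[of "stretch z"] by (simp add: stretch_def)
  also have "\<dots> \<le> norm z * 2"
    using abs_Re_le_cmod[of z] abs_Im_le_cmod[of z] by (simp add: abs_mult)
  finally show "norm (stretch z) \<le> norm z * 2" .
qed (auto simp: stretch_def plane_eq_iff algebra_simps add_divide_distrib)

lemma linear_stretch: "linear stretch" and surj_stretch: "surj stretch"
proof -
  show "linear stretch" by (rule bounded_linear.linear[OF bounded_linear_stretch])
  show "surj stretch"
    by (rule surjI[of _ "\<lambda>v. Complex (2 * v$1) (4/5 * v$2)"]) (simp add: stretch_def plane_eq_iff)
qed

lemma inj_stretch: "inj stretch"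
  by (rule injI) (auto simp: stretch_def plane_eq_iff complex_eq_iff)

lemma open_image_if_locally_open:
  fixes f :: "'a::topological_space \<Rightarrow> 'b::topological_space"
  assumes "\<And>x. x \<in> U \<Longrightarrow> \<exists>N. open N \<and> x \<in> N \<and> (\<forall>V. open V \<and> V \<subseteq> N \<longrightarrow> open (f ` V))"
    and "open U"
  shows "open (f ` U)"
proof (subst open_subopen, intro ballI)
  fix y assume "y \<in> f ` U"
  then obtain x where x: "x \<in> U" "y = f x" by blast
  then obtain N where N: "open N" "x \<in> N" "\<forall>V. open V \<and> V \<subseteq> N \<longrightarrow> open (f ` V)"
    using assms(1) by blast
  have "open (f ` (U \<inter> N))" using N assms(2) by blast
  then show "\<exists>T. open T \<and> y \<in> T \<and> T \<subseteq> f ` U" using x N(2) by blast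
qed

lemma wander_stretch_perturb:
  assumes "(norm v)\<^sup>2 \<ge> 36/25"
  shows "wander v = stretch (perturb (to_cx v))"
  using tent_outside[OF tent_bead_support[OF assms]] by (simp add: wander_def plane_eq_iff)

lemma wander_inj_near: "inj_on wander {v. (norm v)\<^sup>2 < 2}"
proof (rule inj_onI)
  fix v w :: plane
  assume vw: "v \<in> {v. (norm v)\<^sup>2 < 2}" "w \<in> {v. (norm v)\<^sup>2 < 2}" and eq: "wander v = wander w"
  have P: "perturb (to_cx v) = to_cx v" "perturb (to_cx w) = to_cx w"
    using vw by (auto intro!: perturb_near)
  have 1: "v$1 = w$1" using arg_cong[OF eq, of "\<lambda>u. u$1"] P by (simp add: wander_nth)
  have 2: "5/4 * v$2 - 3/4 * tent (bead_height (v$1)) (v$2) = 5/4 * w$2 - 3/4 * tent (bead_height (v$1)) (w$2)"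
    using arg_cong[OF eq, of "\<lambda>u. u$2"] P 1 by (simp add: wander_nth)
  have "v$2 = w$2"
    using tent_difference_le[OF bead_height_nonneg, of "v$2" "w$2" "v$1"]
      tent_difference_le[OF bead_height_nonneg, of "w$2" "v$2" "v$1"] 2
    by (cases "v$2" "w$2" rule: linorder_cases) auto
  then show "v = w" using 1 by (simp add: plane_eq_iff)
qed

lemma wander_inj_middle: "inj_on wander {v. 36/25 < (norm v)\<^sup>2 \<and> norm v < 3}"
proof (rule inj_onI)
  fix v w :: plane
  assume vw: "v \<in> {v. 36/25 < (norm v)\<^sup>2 \<and> norm v < 3}" "w \<in> {v. 36/25 < (norm v)\<^sup>2 \<and> norm v < 3}"
    and eq: "wander v = wander w"
  then have "perturb (to_cx v) = perturb (to_cx w)"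
    using injD[OF inj_stretch] by (auto simp: wander_stretch_perturb)
  then have "norm (to_cx v - to_cx w) = norm ((perturb (to_cx v) - to_cx v) - (perturb (to_cx w) - to_cx w))"
    by (simp add: norm_minus_commute)
  also have "\<dots> \<le> (5 * 3 ^ 4 + 3 ^ 6) / 40000 * norm (to_cx v - to_cx w)"
    by (rule perturb_lipschitz) (use vw in auto)
  finally have "norm (v - w) = 0" unfolding to_cx_diff norm_to_cx by simp
  then show "v = w" by simp
qed

text \<open>In this region \<open>wander\<close> is a linear isomorphism after a polynomial, and it contains the critical
points, where injectivity fails.\<close>

lemma wander_open_far:
  assumes "open V" "V \<subseteq> {v. 4 < (norm v)\<^sup>2}"
  shows "open (wander ` V)"
proof -
  define F :: "complex \<Rightarrow> complex" where "F z = z + z ^ 5 / 40000" for z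
  have lin: "linear to_cx" by (rule bounded_linear.linear[OF bounded_linear_to_cx])
  have "open (F ` (to_cx ` V))"
  proof (rule open_mapping_thm[of F UNIV])
    show "F holomorphic_on UNIV" unfolding F_def by (intro holomorphic_intros) auto
    have "F 1 \<noteq> F 0" by (simp add: F_def complex_eq_iff)
    then show "\<not> F constant_on UNIV" unfolding constant_on_def by (metis UNIV_I)
    show "open (to_cx ` V)" by (rule open_surjective_linear_image[OF assms(1) lin surj_to_cx])
  qed auto
  then have "open (stretch ` F ` to_cx ` V)"
    by (rule open_surjective_linear_image[OF _ linear_stretch surj_stretch])
  moreover have "wander v = stretch (F (to_cx v))" if "v \<in> V" for v
    using assms(2) that by (force simp: wander_stretch_perturb perturb_far F_def)
  then have "stretch ` F ` to_cx ` V = wander ` V" by (force simp: image_image)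
  ultimately show ?thesis by simp
qed

text \<open>Three overlapping regions cover the plane: near the origin and in the middle the map is injective and
invariance of domain applies; far away it is polynomial up to linear maps.\<close>

lemma open_wander:
  assumes "open U"
  shows "open (wander ` U)"
proof (rule open_image_if_locally_open[OF _ assms])
  fix v :: plane
  define N where "N = (if (norm v)\<^sup>2 < 2 then {v::plane. (norm v)\<^sup>2 < 2}
     else if norm v < 3 then {v. 36/25 < (norm v)\<^sup>2 \<and> norm v < 3} else {v. 4 < (norm v)\<^sup>2})"
  have "open N"
    unfolding N_def by (auto intro!: open_Collect_less open_Collect_conj continuous_intros)
  moreover have "v \<in> N"
  proof -
    have "4 < (norm v)\<^sup>2" if "3 \<le> norm v"
      using power_mono[OF that, of 2] by simp
    then show ?thesis by (auto simp: N_def)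
  qed
  moreover have "open (wander ` V)" if V: "open V" "V \<subseteq> N" for V
  proof (cases "(norm v)\<^sup>2 < 2 \<or> norm v < 3")
    case True
    then have "inj_on wander N"
      unfolding N_def using wander_inj_near wander_inj_middle by auto
    then show ?thesis
      using invariance_of_domain[OF continuous_on_wander V(1)] inj_on_subset V(2) by blast
  next
    case False
    then show ?thesis using wander_open_far[OF V(1)] V(2) by (auto simp: N_def)
  qed
  ultimately show "\<exists>N. open N \<and> v \<in> N \<and> (\<forall>V. open V \<and> V \<subseteq> N \<longrightarrow> open (wander ` V))"
    by blast
qed

section \<open>Dilatation and degree\<close>

lemma derivative_matrix_criterion:
  assumes "(f has_derivative D) (at x)"
    and "(D (pt 1 0) $ 1)\<^sup>2 + (D (pt 0 1) $ 1)\<^sup>2 + (D (pt 1 0) $ 2)\<^sup>2 + (D (pt 0 1) $ 2)\<^sup>2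
       \<le> K * (D (pt 1 0) $ 1 * D (pt 0 1) $ 2 - D (pt 0 1) $ 1 * D (pt 1 0) $ 2)"
  shows "\<exists>A. (f has_derivative (*v) A) (at x) \<and> frobenius_sq A \<le> K * det A"
proof (intro exI conjI)
  have "(*v) (matrix D) = D"
    using matrix_vector_mul(3)[OF has_derivative_bounded_linear[OF assms(1)]] by simp
  then show "(f has_derivative (*v) (matrix D)) (at x)" using assms(1) by simp
  show "frobenius_sq (matrix D) \<le> K * det (matrix D)"
    using assms(2) by (simp add: frobenius_sq_def det_2 matrix_def axis_pt)
qed

text \<open>Either the derivative is complex linear, where \<open>perturb\<close> is holomorphic, or it is close to the
identity, in the annulus where the cut-off varies. The critical points only occur in the first case.\<close>

lemma perturb_deriv:
  assumes "(norm z)\<^sup>2 \<noteq> 2" "(norm z)\<^sup>2 \<noteq> 4"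
  obtains E where "(perturb has_derivative E) (at z)"
    "(\<exists>\<alpha>. E = (*) \<alpha>) \<or> (\<forall>h. norm (E h - h) \<le> norm h / 100)"
proof -
  have open_lt: "open {w::complex. (norm w)\<^sup>2 < c}" and open_gt: "open {w::complex. c < (norm w)\<^sup>2}" for c
    by (intro open_Collect_less continuous_intros)+
  consider "(norm z)\<^sup>2 < 2" | "2 < (norm z)\<^sup>2" "(norm z)\<^sup>2 < 4" | "4 < (norm z)\<^sup>2"
    using assms by linarith
  then show ?thesis
  proof cases
    case 1
    have e: "(*) (1::complex) = (\<lambda>h. h)" by (rule ext) simp
    have "(perturb has_derivative (*) 1) (at z)"
      unfolding e
      by (rule has_derivative_transform_within_open[OF _ open_lt[of 2], of "\<lambda>w. w"])
        (use 1 in \<open>auto simp: perturb_near\<close>)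
    then show ?thesis using that by blast
  next
    case 3
    have "((\<lambda>w. w + w ^ 5 / 40000) has_field_derivative 1 + 5 * z ^ 4 / 40000) (at z)"
      by (auto intro!: derivative_eq_intros)
    then have "((\<lambda>w. w + w ^ 5 / 40000) has_derivative (*) (1 + 5 * z ^ 4 / 40000)) (at z)"
      by (simp add: has_field_derivative_def)
    then have "(perturb has_derivative (*) (1 + 5 * z ^ 4 / 40000)) (at z)"
      by (rule has_derivative_transform_within_open[OF _ open_gt[of 4]])
        (use 3 in \<open>auto simp: perturb_far\<close>)
    then show ?thesis using that by blast
  next
    case 2
    define E where "E h = h + (of_real ((z \<bullet> z - 2) / 80000) * (5 * z ^ 4 * h)
        + of_real ((2 * (z \<bullet> h)) / 80000) * z ^ 5)" for h
    have "((\<lambda>w. w \<bullet> w) has_derivative (\<lambda>h. 2 * (z \<bullet> h))) (at z)"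
      by (auto intro!: derivative_eq_intros simp: inner_commute)
    then have "((\<lambda>w. (w \<bullet> w - 2) *\<^sub>R (1 / 80000 :: real)) has_derivative (\<lambda>h. (2 * (z \<bullet> h) - 0) *\<^sub>R (1 / 80000 :: real))) (at z)"
      by (intro has_derivative_scaleR_left has_derivative_diff has_derivative_const)
    then have a: "((\<lambda>w. complex_of_real ((w \<bullet> w - 2) / 80000)) has_derivative
        (\<lambda>h. of_real ((2 * (z \<bullet> h)) / 80000))) (at z)"
      by (intro has_derivative_of_real) simp
    have "((\<lambda>w. w ^ 5) has_field_derivative 5 * z ^ 4) (at z)"
      by (auto intro!: derivative_eq_intros)
    then have b: "((\<lambda>w. w ^ 5) has_derivative (\<lambda>h. 5 * z ^ 4 * h)) (at z)"
      by (simp add: has_field_derivative_def)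
    have F: "((\<lambda>w. w + of_real ((w \<bullet> w - 2) / 80000) * w ^ 5) has_derivative E) (at z)"
      unfolding E_def by (rule has_derivative_add[OF has_derivative_ident has_derivative_mult[OF a b]])
    have P: "w + of_real ((w \<bullet> w - 2) / 80000) * w ^ 5 = perturb w"
      if "2 < (norm w)\<^sup>2" "(norm w)\<^sup>2 < 4" for w
      using that by (simp add: perturb_def cutoff_def power2_norm_eq_inner)
    have E: "(perturb has_derivative E) (at z)"
    proof (rule has_derivative_transform_within_open[OF F open_Int[OF open_gt[of 2] open_lt[of 4]]])
      show "w + of_real ((w \<bullet> w - 2) / 80000) * w ^ 5 = perturb w"
        if "w \<in> {w. 2 < (norm w)\<^sup>2} \<inter> {w. (norm w)\<^sup>2 < 4}" for w
        by (rule P) (use that in auto)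
    qed (use 2 in simp_all)
    have z2: "norm z \<le> 2" by (rule power2_le_imp_le) (use 2 in auto)
    have "norm (E h - h) \<le> norm h / 100" for h
    proof -
      have i: "\<bar>z \<bullet> h\<bar> \<le> 2 * norm h"
        using Cauchy_Schwarz_ineq2[of z h] mult_right_mono[OF z2 norm_ge_zero[of h]] by linarith
      have p: "norm (z ^ n) \<le> 2 ^ n" for n
        unfolding norm_power using z2 by (intro power_mono) auto
      have t0: "norm (E h - h) \<le> norm (of_real ((z \<bullet> z - 2) / 80000) * (5 * z ^ 4 * h))
          + norm (of_real ((2 * (z \<bullet> h)) / 80000) * z ^ 5)"
        unfolding E_def add_diff_cancel_left' by (rule norm_triangle_ineq)
      have t1: "norm (of_real ((z \<bullet> z - 2) / 80000) * (5 * z ^ 4 * h)) \<le> 2 / 80000 * (5 * 2 ^ 4 * norm h)"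
        unfolding norm_mult[of "of_real _"] norm_of_real
      proof (intro mult_mono)
        show "\<bar>(z \<bullet> z - 2) / 80000\<bar> \<le> 2 / 80000"
          using 2 by (simp add: power2_norm_eq_inner)
        show "norm (5 * z ^ 4 * h) \<le> 5 * 2 ^ 4 * norm h"
          unfolding norm_mult using p[of 4] by (intro mult_right_mono) auto
      qed auto
      have t2: "norm (of_real ((2 * (z \<bullet> h)) / 80000) * z ^ 5) \<le> (4 * norm h / 80000) * 2 ^ 5"
        unfolding norm_mult norm_of_real using i p[of 5] by (intro mult_mono) auto
      have "2 / 80000 * (5 * 2 ^ 4 * norm h) + (4 * norm h / 80000) * 2 ^ 5 \<le> norm h / 100"
        by simp
      then show ?thesis using t0 t1 t2 by linarith
    qed
    then show ?thesis using that E by blast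
  qed
qed

lemma stretch_conformal_bound:
  fixes p q :: real
  shows "(p / 2)\<^sup>2 + (- q / 2)\<^sup>2 + (5/4 * q)\<^sup>2 + (5/4 * p)\<^sup>2
       \<le> 9/2 * (p / 2 * (5/4 * p) - (- q / 2) * (5/4 * q))"
  using zero_le_power2[of p] zero_le_power2[of q] by (simp add: power2_eq_square field_simps)

lemma stretch_near_identity_bound:
  fixes a b c d :: real
  assumes "\<bar>a - 1\<bar> \<le> 1/100" "\<bar>b\<bar> \<le> 1/100" "\<bar>c\<bar> \<le> 1/100" "\<bar>d - 1\<bar> \<le> 1/100"
  shows "(a / 2)\<^sup>2 + (b / 2)\<^sup>2 + (5/4 * c)\<^sup>2 + (5/4 * d)\<^sup>2
       \<le> 9/2 * (a / 2 * (5/4 * d) - b / 2 * (5/4 * c))"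
proof -
  have ad: "99/100 \<le> a" "a \<le> 101/100" "99/100 \<le> d" "d \<le> 101/100" using assms by linarith+
  have "(99/100) * (99/100) \<le> a * d" using ad by (intro mult_mono) auto
  moreover have "a\<^sup>2 \<le> (101/100)\<^sup>2" "d\<^sup>2 \<le> (101/100)\<^sup>2" using ad by (auto intro!: power_mono)
  moreover have "b\<^sup>2 \<le> (1/100)\<^sup>2" "c\<^sup>2 \<le> (1/100)\<^sup>2"
    using assms abs_le_square_iff[of b "1/100"] abs_le_square_iff[of c "1/100"] by auto
  moreover have "\<bar>b * c\<bar> \<le> 1/100 * (1/100)" unfolding abs_mult using assms by (intro mult_mono) auto
  then have "b * c \<le> 1/10000" by auto
  ultimately show ?thesis by (simp add: power2_eq_square field_simps)
qed

text \<open>Off the support of the tent the derivative is that of \<open>perturb\<close> followed by \<open>diag (1/2, 5/4)\<close>; in a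
bead it is a homothety. The worst case is the descending part of the tent, where the vertical
derivative is \<open>5/4 + 3/4 = 2\<close>: there the squared Frobenius norm is \<open>1/4 + 4\<close> plus the square of the small shear, and the
determinant is 1.\<close>

lemma wander_deriv:
  assumes r: "(norm v)\<^sup>2 \<noteq> 2" "(norm v)\<^sup>2 \<noteq> 4"
    and g: "\<bar>v$2\<bar> \<noteq> bead_height (v$1)" "\<bar>v$2\<bar> \<noteq> 2 * bead_height (v$1)"
  shows "\<exists>A. (wander has_derivative (*v) A) (at v) \<and> frobenius_sq A \<le> 9/2 * det A"
proof -
  note cb = continuous_on_compose2[OF continuous_on_bead_height[of UNIV]]
  have d1: "((\<lambda>w::plane. w$i) has_derivative (\<lambda>h. h$i)) (at v)" for i
    by (rule bounded_linear_imp_has_derivative) (rule bounded_linear_vec_nth)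
  have half: "((\<lambda>w::plane. w$i / 2) has_derivative (\<lambda>h. h$i / 2)) (at v)" for i
    using has_derivative_scaleR_right[OF d1[of i], of "1/2"] by simp
  have id: "to_cx (pt 1 0) = 1" "to_cx (pt 0 1) = \<i>" by (auto simp: complex_eq_iff)
  have small: "(norm w)\<^sup>2 \<le> 2" if "\<bar>w$2\<bar> < 2 * bead_height (w$1)" for w :: plane
    using tent_bead_support[of w] that by linarith
  have near: "wander w = pt (w$1 / 2) (5/4 * w$2 - 3/4 * tent (bead_height (w$1)) (w$2))"
    if "\<bar>w$2\<bar> < 2 * bead_height (w$1)" for w :: plane
    using perturb_near[of "to_cx w"] small[OF that] by (simp add: plane_eq_iff wander_nth)
  consider "\<bar>v$2\<bar> > 2 * bead_height (v$1)" | "\<bar>v$2\<bar> < bead_height (v$1)"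
    | "\<bar>v$2\<bar> > bead_height (v$1)" "\<bar>v$2\<bar> < 2 * bead_height (v$1)" using g by linarith
  then show ?thesis
  proof cases
    case 1
    obtain E where E: "(perturb has_derivative E) (at (to_cx v))"
      "(\<exists>\<alpha>. E = (*) \<alpha>) \<or> (\<forall>h. norm (E h - h) \<le> norm h / 100)"
      using perturb_deriv[of "to_cx v"] r by auto
    have "((\<lambda>w. perturb (to_cx w)) has_derivative (\<lambda>h. E (to_cx h))) (at v)"
      using has_derivative_compose[OF bounded_linear_imp_has_derivative[OF bounded_linear_to_cx] E(1)] .
    then have "((\<lambda>w. stretch (perturb (to_cx w))) has_derivative (\<lambda>h. stretch (E (to_cx h)))) (at v)"
      by (rule bounded_linear.has_derivative[OF bounded_linear_stretch])
    then have "(wander has_derivative (\<lambda>h. stretch (E (to_cx h)))) (at v)"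
    proof (rule has_derivative_transform_within_open)
      show "open {w::plane. 2 * bead_height (w$1) < \<bar>w$2\<bar>}"
        by (intro open_Collect_less continuous_intros cb) auto
    qed (use 1 in \<open>auto simp: wander_def tent_outside plane_eq_iff\<close>)
    then show ?thesis
    proof (rule derivative_matrix_criterion)
      from E(2) show "(stretch (E (to_cx (pt 1 0))) $ 1)\<^sup>2 + (stretch (E (to_cx (pt 0 1))) $ 1)\<^sup>2 +
          (stretch (E (to_cx (pt 1 0))) $ 2)\<^sup>2 + (stretch (E (to_cx (pt 0 1))) $ 2)\<^sup>2
        \<le> 9 / 2 * (stretch (E (to_cx (pt 1 0))) $ 1 * stretch (E (to_cx (pt 0 1))) $ 2 -
          stretch (E (to_cx (pt 0 1))) $ 1 * stretch (E (to_cx (pt 1 0))) $ 2)"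
      proof
        assume "\<exists>\<alpha>. E = (*) \<alpha>"
        then obtain \<alpha> where \<alpha>: "E = (*) \<alpha>" by blast
        show ?thesis
          using stretch_conformal_bound[of "Re \<alpha>" "Im \<alpha>"] by (simp add: \<alpha> stretch_def id)
      next
        assume e: "\<forall>h. norm (E h - h) \<le> norm h / 100"
        have n: "norm (E 1 - 1) \<le> 1/100" "norm (E \<i> - \<i>) \<le> 1/100"
          using e[rule_format, of 1] e[rule_format, of \<i>] by simp_all
        have "\<bar>Re (E 1 - 1)\<bar> \<le> 1/100" "\<bar>Im (E 1 - 1)\<bar> \<le> 1/100"
          "\<bar>Re (E \<i> - \<i>)\<bar> \<le> 1/100" "\<bar>Im (E \<i> - \<i>)\<bar> \<le> 1/100"
          by (rule order_trans[OF abs_Re_le_cmod n(1)] order_trans[OF abs_Im_le_cmod n(1)]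
              order_trans[OF abs_Re_le_cmod n(2)] order_trans[OF abs_Im_le_cmod n(2)])+
        then show ?thesis
          using stretch_near_identity_bound[of "Re (E 1)" "Re (E \<i>)" "Im (E 1)" "Im (E \<i>)"]
          by (simp add: stretch_def id)
      qed
    qed
  next
    case 2
    have "((\<lambda>w. pt (w$1 / 2) (w$2 / 2)) has_derivative (\<lambda>h. pt (h$1 / 2) (h$2 / 2))) (at v)"
      by (rule has_derivative_pt[OF half half])
    then have "(wander has_derivative (\<lambda>h. pt (h$1 / 2) (h$2 / 2))) (at v)"
    proof (rule has_derivative_transform_within_open)
      show "open {w::plane. \<bar>w$2\<bar> < bead_height (w$1)}"
        by (intro open_Collect_less continuous_intros cb) auto
    qed (use 2 in \<open>auto simp: near tent_inside\<close>)
    then show ?thesis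
      by (rule derivative_matrix_criterion) (simp add: power2_eq_square)
  next
    case 3
    \<comment> \<open>The sign of the ordinate is locally constant and serves both halves of the plane at once.\<close>
    define s where "s = sgn (v$2)"
    have s2: "s * s = 1" and v2: "v$2 \<noteq> 0"
      using 3(1) bead_height_nonneg[of "v$1"] by (auto simp: s_def sgn_if)
    have "bead_height (v$1) \<noteq> 0" using 3 by auto
    then have "0 < v$1" "v$1 < 1" unfolding bead_height_def by (auto split: if_splits)
    then obtain d where d: "(bead_height has_real_derivative d) (at (v$1))" "\<bar>d\<bar> \<le> 17/100"
      using bead_height_deriv by blast
    have db: "((\<lambda>w. bead_height (w$1)) has_derivative (\<lambda>h. d * h$1)) (at v)"
      using has_derivative_compose[OF d1[of 1] d(1)[unfolded has_field_derivative_def]] .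
    have "((\<lambda>w. pt (w$1 / 2) (2 * w$2 - 3/2 * s * bead_height (w$1)))
        has_derivative (\<lambda>h. pt (h$1 / 2) (2 * h$2 - 3/2 * s * (d * h$1)))) (at v)"
      by (intro has_derivative_pt[OF half] has_derivative_diff has_derivative_mult_right d1 db)
    then have "(wander has_derivative (\<lambda>h. pt (h$1 / 2) (2 * h$2 - 3/2 * s * (d * h$1)))) (at v)"
    proof (rule has_derivative_transform_within_open)
      show "open ({w::plane. bead_height (w$1) < \<bar>w$2\<bar>} \<inter> {w. \<bar>w$2\<bar> < 2 * bead_height (w$1)}
          \<inter> {w. 0 < s * w$2})"
        by (intro open_Int open_Collect_less continuous_intros cb) auto
      show "v \<in> {w::plane. bead_height (w$1) < \<bar>w$2\<bar>} \<inter> {w. \<bar>w$2\<bar> < 2 * bead_height (w$1)}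
          \<inter> {w. 0 < s * w$2}"
        using 3 v2 by (auto simp: s_def sgn_if)
      fix w assume w: "w \<in> {w::plane. bead_height (w$1) < \<bar>w$2\<bar>} \<inter> {w. \<bar>w$2\<bar> < 2 * bead_height (w$1)}
          \<inter> {w. 0 < s * w$2}"
      then have "sgn (w$2) = s" using v2 by (auto simp: s_def sgn_if split: if_splits)
      then show "pt (w$1 / 2) (2 * w$2 - 3/2 * s * bead_height (w$1)) = wander w"
        using w by (simp add: near tent_between plane_eq_iff field_simps)
    qed
    then show ?thesis
    proof (rule derivative_matrix_criterion)
      have "(3/2 * s * d)\<^sup>2 = 9/4 * (s * s) * d\<^sup>2" by (simp add: power2_eq_square)
      also have "\<dots> \<le> 9/4 * (17/100)\<^sup>2"
        using d(2) abs_le_square_iff[of d "17/100"] by (simp add: s2)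
      finally show "(pt (pt 1 0 $ 1 / 2) (2 * pt 1 0 $ 2 - 3 / 2 * s * (d * pt 1 0 $ 1)) $ 1)\<^sup>2 +
          (pt (pt 0 1 $ 1 / 2) (2 * pt 0 1 $ 2 - 3 / 2 * s * (d * pt 0 1 $ 1)) $ 1)\<^sup>2 +
          (pt (pt 1 0 $ 1 / 2) (2 * pt 1 0 $ 2 - 3 / 2 * s * (d * pt 1 0 $ 1)) $ 2)\<^sup>2 +
          (pt (pt 0 1 $ 1 / 2) (2 * pt 0 1 $ 2 - 3 / 2 * s * (d * pt 0 1 $ 1)) $ 2)\<^sup>2
        \<le> 9 / 2 * (pt (pt 1 0 $ 1 / 2) (2 * pt 1 0 $ 2 - 3 / 2 * s * (d * pt 1 0 $ 1)) $ 1 *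
            pt (pt 0 1 $ 1 / 2) (2 * pt 0 1 $ 2 - 3 / 2 * s * (d * pt 0 1 $ 1)) $ 2 -
          pt (pt 0 1 $ 1 / 2) (2 * pt 0 1 $ 2 - 3 / 2 * s * (d * pt 0 1 $ 1)) $ 1 *
          pt (pt 1 0 $ 1 / 2) (2 * pt 1 0 $ 2 - 3 / 2 * s * (d * pt 1 0 $ 1)) $ 2)"
        by (simp add: power2_eq_square)
    qed
  qed
qed

text \<open>The graph is the image of the horizontal axis under a Lipschitz shear.\<close>

lemma negligible_graph:
  fixes f :: "real \<Rightarrow> real"
  assumes "\<And>x y. \<bar>f x - f y\<bar> \<le> C * \<bar>x - y\<bar>"
  shows "negligible {v::plane. v$2 = f (v$1)}"
proof -
  have "negligible ((\<lambda>v. pt (v$1) (v$2 + f (v$1))) ` {v::plane. v$2 = 0})"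
  proof (rule negligible_locally_Lipschitz_image)
    show "negligible {v::plane. v$2 = 0}" by (rule negligible_standard_hyperplane_cart)
    fix x :: plane assume "x \<in> {v. v$2 = 0}"
    have "norm (pt (y$1) (y$2 + f (y$1)) - pt (x$1) (x$2 + f (x$1))) \<le> (2 + \<bar>C\<bar>) * norm (y - x)" for y :: plane
    proof -
      have c: "\<bar>y$1 - x$1\<bar> \<le> norm (y - x)" "\<bar>y$2 - x$2\<bar> \<le> norm (y - x)"
        using component_le_norm_cart[of "y - x"] by (metis vector_minus_component)+
      have "\<bar>f (y$1) - f (x$1)\<bar> \<le> \<bar>C\<bar> * \<bar>y$1 - x$1\<bar>"
        using assms[of "y$1" "x$1"] mult_right_mono[of C "\<bar>C\<bar>" "\<bar>y$1 - x$1\<bar>"] by linarith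
      also have "\<dots> \<le> \<bar>C\<bar> * norm (y - x)" using c by (intro mult_left_mono) auto
      finally have f: "\<bar>f (y$1) - f (x$1)\<bar> \<le> \<bar>C\<bar> * norm (y - x)" .
      have "norm (pt (y$1) (y$2 + f (y$1)) - pt (x$1) (x$2 + f (x$1)))
          \<le> \<bar>y$1 - x$1\<bar> + \<bar>(y$2 - x$2) + (f (y$1) - f (x$1))\<bar>"
        using norm_plane_le[of "pt (y$1) (y$2 + f (y$1)) - pt (x$1) (x$2 + f (x$1))"]
        by (simp add: algebra_simps)
      also have "\<dots> \<le> (2 + \<bar>C\<bar>) * norm (y - x)"
        using c f abs_triangle_ineq[of "y$2 - x$2" "f (y$1) - f (x$1)"] by (simp add: distrib_right)
      finally show ?thesis .
    qed
    then show "\<exists>T B. open T \<and> x \<in> T \<and> (\<forall>y\<in>{v. v$2 = 0} \<inter> T.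
        norm (pt (y$1) (y$2 + f (y$1)) - pt (x$1) (x$2 + f (x$1))) \<le> B * norm (y - x))"
      by (intro exI[of _ UNIV] exI[of _ "2 + \<bar>C\<bar>"] conjI) (rule open_UNIV, rule UNIV_I, blast)
  qed auto
  moreover have "{v::plane. v$2 = f (v$1)} \<subseteq> (\<lambda>v. pt (v$1) (v$2 + f (v$1))) ` {v::plane. v$2 = 0}"
  proof
    fix v :: plane assume "v \<in> {v. v$2 = f (v$1)}"
    then show "v \<in> (\<lambda>v. pt (v$1) (v$2 + f (v$1))) ` {v::plane. v$2 = 0}"
      by (intro image_eqI[of _ _ "pt (v$1) 0"]) (auto simp: plane_eq_iff)
  qed
  ultimately show ?thesis by (rule negligible_subset)
qed

lemma wander_K_quasiregular: "K_quasiregular (9/2) UNIV wander"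
proof (rule K_quasiregular_of_lipschitz)
  define N where "N = sphere (0::plane) (sqrt 2) \<union> sphere 0 2 \<union>
     (\<Union>s\<in>{1, -1, 2, -2}. {v. v$2 = s * bead_height (v$1)})"
  have graph: "negligible {v::plane. v$2 = s * bead_height (v$1)}" for s
  proof (rule negligible_graph[where C = "\<bar>s\<bar>"])
    show "\<bar>s * bead_height x - s * bead_height y\<bar> \<le> \<bar>s\<bar> * \<bar>x - y\<bar>" for x y
      unfolding right_diff_distrib[symmetric] abs_mult
      by (intro mult_left_mono bead_height_lipschitz) auto
  qed
  have "negligible (\<Union>s\<in>{1, -1, 2, -2}. {v::plane. v$2 = s * bead_height (v$1)})"
    by (rule negligible_Union) (use graph in blast)+
  then have "negligible N"
    unfolding N_def by (intro negligible_Un negligible_sphere)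
  moreover have "{v. \<not> (\<exists>A. (wander has_derivative (*v) A) (at v) \<and> frobenius_sq A \<le> 9/2 * det A)} \<subseteq> N"
  proof (rule subsetI, rule ccontr)
    fix v assume v: "v \<in> {v. \<not> (\<exists>A. (wander has_derivative (*v) A) (at v) \<and> frobenius_sq A \<le> 9/2 * det A)}"
      and n: "v \<notin> N"
    have "(norm v)\<^sup>2 \<noteq> 2" "(norm v)\<^sup>2 \<noteq> 4"
      using n real_sqrt_unique[of "norm v" 2] real_sqrt_unique[of "norm v" 4] by (auto simp: N_def)
    moreover have "\<bar>v$2\<bar> \<noteq> bead_height (v$1)" "\<bar>v$2\<bar> \<noteq> 2 * bead_height (v$1)"
      using n by (auto simp: N_def abs_if split: if_splits)
    ultimately show False using wander_deriv v by blast
  qed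
  ultimately have "AE v in lebesgue. \<exists>A. (wander has_derivative (*v) A) (at v) \<and> frobenius_sq A \<le> 9/2 * det A"
    unfolding eventually_ae_filter_negligible by blast
  then show "AE v in lborel. \<exists>A. (wander has_derivative (*v) A) (at v) \<and> frobenius_sq A \<le> 9/2 * det A"
    by (simp only: AE_completion_iff)
qed (auto intro: wander_lipschitz)

lemma wander_degree: "5 \<le> map_degree wander"
proof -
  define S where "S = {pt 0 0, pt 10 10, pt 10 (- 10), pt (- 10) 10, pt (- 10) (- 10)}"
  have b: "tent (bead_height x) y = 0" if "(pt x y) \<in> S" for x y
    using that by (auto simp: S_def plane_eq_iff bead_height_def tent_outside)
  have "wander v = 0" if v: "v \<in> S" for v
  proof -
    have "perturb (to_cx v) = 0"
    proof (cases "v = pt 0 0")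
      case True
      then have "to_cx v = 0" by (simp add: complex_eq_iff)
      then show ?thesis by (simp add: perturb_def)
    next
      case False
      then have "(v$1)\<^sup>2 = 100" "(v$2)\<^sup>2 = 100" using v by (auto simp: S_def)
      then have n: "(norm (to_cx v))\<^sup>2 \<ge> 4" by (simp add: norm_plane_sq)
      have "(to_cx v)\<^sup>2 = Complex 0 (2 * (v$1 * v$2))"
        using \<open>(v$1)\<^sup>2 = 100\<close> \<open>(v$2)\<^sup>2 = 100\<close> by (simp add: complex_eq_iff power2_eq_square)
      then have "((to_cx v)\<^sup>2)\<^sup>2 = - of_real (4 * (v$1 * v$2)\<^sup>2)"
        by (simp add: complex_eq_iff power2_eq_square)
      moreover have "(v$1 * v$2)\<^sup>2 = 10000"
        using \<open>(v$1)\<^sup>2 = 100\<close> \<open>(v$2)\<^sup>2 = 100\<close> by (simp add: power_mult_distrib)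
      ultimately have "((to_cx v)\<^sup>2)\<^sup>2 = - 40000" by (simp only:) simp
      then have "to_cx v ^ 4 = - 40000" by (simp flip: power_mult)
      moreover have "to_cx v ^ 5 = to_cx v * to_cx v ^ 4" by (simp add: eval_nat_numeral)
      ultimately show ?thesis by (simp add: perturb_far[OF n])
    qed
    moreover have "pt (v$1) (v$2) = v" by (simp add: plane_eq_iff)
    then have "tent (bead_height (v$1)) (v$2) = 0" using b[of "v$1" "v$2"] v by simp
    ultimately show ?thesis by (simp add: plane_eq_iff wander_nth)
  qed
  then have sub: "S \<subseteq> wander -` {0}" by auto
  have c: "card S = 5" by (simp add: S_def card_insert_if plane_eq_iff)
  have "5 \<le> ecardinal (wander -` {0})"
  proof (cases "finite (wander -` {0})")
    case True
    then have "5 \<le> card (wander -` {0})" using card_mono[OF True sub] c by simp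
    then show ?thesis using True by (simp add: ecardinal_def numeral_eq_enat)
  qed (simp add: ecardinal_def)
  also have "\<dots> \<le> map_degree wander" unfolding map_degree_def by (rule SUP_upper) simp
  finally show ?thesis .
qed

section \<open>Dynamics of continuous open maps\<close>

lemma funpow_in_escaping_set: "(f ^^ n) x \<in> escaping_set f \<longleftrightarrow> x \<in> escaping_set f"
proof (induction n)
  case (Suc n)
  have "f y \<in> escaping_set f \<longleftrightarrow> y \<in> escaping_set f" for y
    using filterlim_sequentially_Suc[of "\<lambda>m. (f ^^ m) y" at_infinity]
    by (simp add: escaping_set_def funpow_swap1)
  then show ?case using Suc by simp
qed simp

text \<open>Continuity carries the closure forward, openness carries it backward.\<close>

lemma completely_invariant_escaping_closure:
  assumes cont: "continuous_on UNIV f" and op: "\<And>U. open U \<Longrightarrow> open (f ` U)"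
  shows "completely_invariant f (UNIV - closure (escaping_set f))"
proof -
  have "f x \<in> closure (escaping_set f) \<longleftrightarrow> x \<in> closure (escaping_set f)" for x
  proof
    assume x: "x \<in> closure (escaping_set f)"
    have fI: "f ` escaping_set f \<subseteq> escaping_set f"
      using funpow_in_escaping_set[of 1 f] by auto
    have "f ` closure (escaping_set f) \<subseteq> closure (f ` escaping_set f)"
      by (rule image_closure_subset[OF continuous_on_subset[OF cont]]) (auto intro: closure_subset[THEN subsetD])
    then show "f x \<in> closure (escaping_set f)" using x closure_mono[OF fI] by blast
  next
    assume fx: "f x \<in> closure (escaping_set f)"
    show "x \<in> closure (escaping_set f)"
    proof (rule ccontr)
      assume x: "x \<notin> closure (escaping_set f)"
      have "open (f ` (- closure (escaping_set f)))" by (rule op) auto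
      moreover have "f x \<in> f ` (- closure (escaping_set f))" using x by blast
      ultimately have "f ` (- closure (escaping_set f)) \<inter> escaping_set f \<noteq> {}"
        using fx open_Int_closure_eq_empty by blast
      then obtain y where "y \<notin> closure (escaping_set f)" "f y \<in> escaping_set f" by blast
      then show False
        using funpow_in_escaping_set[of 1 f y] closure_subset[of "escaping_set f"] by auto
    qed
  qed
  then show ?thesis by (simp add: completely_invariant_def)
qed

lemma open_fatou_set: "open (fatou_set f)"
  by (subst open_subopen) (auto simp: fatou_set_def)

lemma to_sphere_continuous: "continuous_on S to_sphere"
proof -
  have "(norm (x::plane))\<^sup>2 + 1 \<noteq> 0" for x
    by (metis add_nonneg_pos less_irrefl zero_le_power2 zero_less_one)
  then show ?thesis
    unfolding to_sphere_def by (intro continuous_intros) auto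
qed

lemma norm_to_sphere: "to_sphere x \<in> sphere 0 1"
proof -
  define a where "a = (norm x)\<^sup>2"
  have a: "a \<ge> 0" by (simp add: a_def)
  have "(norm (to_sphere x))\<^sup>2 = (2 / (a + 1))\<^sup>2 * a + ((a - 1) / (a + 1))\<^sup>2"
    by (simp add: to_sphere_def norm_Pair power_mult_distrib power_divide a_def)
  also have "\<dots> = (4 * a + (a - 1)\<^sup>2) / (a + 1)\<^sup>2"
    by (simp add: power_divide add_divide_distrib)
  also have "4 * a + (a - 1)\<^sup>2 = (a + 1)\<^sup>2" by (simp add: power2_eq_square algebra_simps)
  finally have "(norm (to_sphere x))\<^sup>2 = 1" using a by simp
  then have "norm (to_sphere x) = 1" using power2_eq_iff_nonneg[of "norm (to_sphere x)" 1] by simp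
  then show ?thesis by simp
qed

lemma tendsto_to_sphere_at_infinity:
  assumes "filterlim f at_infinity F"
  shows "((\<lambda>n. to_sphere (f n)) \<longlongrightarrow> (0, 1)) F"
proof -
  have n: "filterlim (\<lambda>n. norm (f n)) at_top F"
    using assms unfolding filterlim_at_infinity_conv_norm_at_top .
  have l1: "((\<lambda>t::real. 2 * t / (t\<^sup>2 + 1)) \<longlongrightarrow> 0) at_top" 
    and l2: "((\<lambda>t::real. (t\<^sup>2 - 1) / (t\<^sup>2 + 1)) \<longlongrightarrow> 1) at_top"
    by real_asymp+
  have "((\<lambda>n. (2 / ((norm (f n))\<^sup>2 + 1)) *\<^sub>R f n) \<longlongrightarrow> 0) F"
  proof (rule tendsto_norm_zero_cancel)
    have "((\<lambda>n. 2 * norm (f n) / ((norm (f n))\<^sup>2 + 1)) \<longlongrightarrow> 0) F"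
      by (rule filterlim_compose[OF l1 n])
    then show "((\<lambda>n. norm ((2 / ((norm (f n))\<^sup>2 + 1)) *\<^sub>R f n)) \<longlongrightarrow> 0) F"
      by (simp add: abs_of_nonneg)
  qed
  moreover have "((\<lambda>n. ((norm (f n))\<^sup>2 - 1) / ((norm (f n))\<^sup>2 + 1)) \<longlongrightarrow> 1) F"
    by (rule filterlim_compose[OF l2 n])
  ultimately show ?thesis unfolding to_sphere_def by (rule tendsto_Pair)
qed

lemma nat_seq_constant_or_at_top:
  fixes m :: "nat \<Rightarrow> nat"
  shows "(\<exists>c (r :: nat \<Rightarrow> nat). strict_mono r \<and> (\<forall>k. m (r k) = c)) \<or> filterlim m at_top sequentially"
proof (cases "\<exists>c. infinite {k. m k = c}")
  case True
  then obtain c where "infinite {k. m k = c}" by blast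
  then obtain r :: "nat \<Rightarrow> nat" where "strict_mono r" "\<forall>k. r k \<in> {k. m k = c}"
    using infinite_enumerate by blast
  then have "strict_mono r \<and> (\<forall>k. m (r k) = c)" by simp
  then show ?thesis by blast
next
  case False
  have "eventually (\<lambda>k. Z \<le> m k) sequentially" for Z
  proof -
    have "{k. \<not> Z \<le> m k} = (\<Union>c<Z. {k. m k = c})" by auto
    then have "finite {k. \<not> Z \<le> m k}" using False by simp
    then show ?thesis by (simp add: eventually_cofinite flip: cofinite_eq_sequentially)
  qed
  then show ?thesis by (simp add: filterlim_at_top)
qed

text \<open>A sequence of iterates either repeats one iterate infinitely often, which gives a constant subsequence, or
its exponents tend to infinity. Only the second case has to be checked.\<close>

lemma normal_family_iteratesI:
  assumes "open U"
    and tail: "\<And>m. filterlim m at_top sequentially \<Longrightarrow> \<exists>r g. strict_mono r \<and> g ` U \<subseteq> sphere 0 1 \<and>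
       locally_uniform_limit U (\<lambda>k. to_sphere \<circ> (f ^^ m (r k))) g"
  shows "normal_family U (range (\<lambda>n. f ^^ n))"
  unfolding normal_family_def
proof (intro allI impI)
  fix s :: "nat \<Rightarrow> plane \<Rightarrow> plane" assume "range s \<subseteq> range (\<lambda>n. f ^^ n)"
  then have "\<forall>k. \<exists>n. s k = f ^^ n" by blast
  then obtain m where m: "\<And>k. s k = f ^^ m k" by metis
  show "\<exists>r g. strict_mono r \<and> g ` U \<subseteq> sphere 0 1 \<and> locally_uniform_limit U (\<lambda>k. to_sphere \<circ> s (r k)) g"
    using nat_seq_constant_or_at_top[of m]
  proof (elim disjE exE conjE)
    fix c and r :: "nat \<Rightarrow> nat" assume r: "strict_mono r" "\<forall>k. m (r k) = c"
    have "locally_uniform_limit U (\<lambda>k. to_sphere \<circ> s (r k)) (to_sphere \<circ> (f ^^ c))"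
      unfolding locally_uniform_limit_def
      using assms(1) by (auto simp: m r(2) uniform_limit_const intro!: exI[of _ U])
    then show ?thesis
      using r(1) norm_to_sphere by (intro exI[of _ r] exI[of _ "to_sphere \<circ> (f ^^ c)"]) auto
  next
    assume "filterlim m at_top sequentially"
    then show ?thesis using tail[of m] by (simp add: m)
  qed
qed

text \<open>If the iterates are normal near \<open>f x\<close>, compose with \<open>f\<close>. Conversely, if they are normal on a
neighbourhood \<open>U\<close> of \<open>x\<close>, then a sequence of iterates on the open set \<open>f ` U\<close> becomes, after composition with \<open>f\<close>, a sequence of iterates on
\<open>U\<close>; its uniform limit descends to \<open>f ` U\<close> because it is determined pointwise.\<close>

lemma completely_invariant_fatou_set:
  assumes cont: "continuous_on UNIV f" and op: "\<And>U. open U \<Longrightarrow> open (f ` U)"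
  shows "completely_invariant f (fatou_set f)"
proof -
  have vim: "open (f -` U)" if "open U" for U
    using open_vimage[OF that cont] .
  have "f x \<in> fatou_set f \<longleftrightarrow> x \<in> fatou_set f" for x
  proof
    assume "f x \<in> fatou_set f"
    then obtain U where U: "open U" "f x \<in> U" "normal_family U (range (\<lambda>n. f ^^ n))"
      by (auto simp: fatou_set_def)
    have "normal_family (f -` U) (range (\<lambda>n. f ^^ n))"
    proof (rule normal_family_iteratesI[OF vim[OF U(1)]])
      fix m :: "nat \<Rightarrow> nat" assume "filterlim m at_top sequentially"
      then have "eventually (\<lambda>k. 1 \<le> m k) sequentially" by (simp add: filterlim_at_top)
      then obtain N where N: "\<And>k. k \<ge> N \<Longrightarrow> 1 \<le> m k" unfolding eventually_sequentially by blast
      obtain r g where rg: "strict_mono r" "g ` U \<subseteq> sphere 0 1"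
        "locally_uniform_limit U (\<lambda>k. to_sphere \<circ> (f ^^ (m (r k + N) - 1))) g"
        using U(3)[unfolded normal_family_def, rule_format, of "\<lambda>k. f ^^ (m (k + N) - 1)"] by auto
      have comp: "(f ^^ m (r k + N)) y = (f ^^ (m (r k + N) - 1)) (f y)" for k y
      proof -
        obtain j where "m (r k + N) = Suc j" using N[of "r k + N"] by (cases "m (r k + N)") auto
        then show ?thesis by (simp add: funpow_swap1)
      qed
      have "locally_uniform_limit (f -` U) (\<lambda>k. to_sphere \<circ> (f ^^ m (r k + N))) (g \<circ> f)"
        unfolding locally_uniform_limit_def
      proof
        fix y assume "y \<in> f -` U"
        then obtain V where V: "open V" "f y \<in> V" "V \<subseteq> U"
          "uniform_limit V (\<lambda>k. to_sphere \<circ> (f ^^ (m (r k + N) - 1))) g sequentially"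
          using rg(3) unfolding locally_uniform_limit_def by blast
        have "uniform_limit (f -` V) (\<lambda>k. to_sphere \<circ> (f ^^ m (r k + N))) (g \<circ> f) sequentially"
          using V(4) unfolding uniform_limit_iff by (fastforce simp: comp elim!: eventually_mono)
        then show "\<exists>V. open V \<and> y \<in> V \<and> V \<subseteq> f -` U \<and>
            uniform_limit V (\<lambda>k. to_sphere \<circ> (f ^^ m (r k + N))) (g \<circ> f) sequentially"
          using V vim by (intro exI[of _ "f -` V"]) auto
      qed
      then show "\<exists>r g. strict_mono r \<and> g ` (f -` U) \<subseteq> sphere 0 1 \<and>
          locally_uniform_limit (f -` U) (\<lambda>k. to_sphere \<circ> (f ^^ m (r k))) g"
        using rg(1,2) by (intro exI[of _ "\<lambda>k. r k + N"] exI[of _ "g \<circ> f"]) (auto simp: strict_mono_def)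
    qed
    then show "x \<in> fatou_set f" using vim[OF U(1)] U(2) by (auto simp: fatou_set_def)
  next
    assume "x \<in> fatou_set f"
    then obtain U where U: "open U" "x \<in> U" "normal_family U (range (\<lambda>n. f ^^ n))"
      by (auto simp: fatou_set_def)
    have "normal_family (f ` U) (range (\<lambda>n. f ^^ n))"
      unfolding normal_family_def
    proof (intro allI impI)
      fix s :: "nat \<Rightarrow> plane \<Rightarrow> plane" assume "range s \<subseteq> range (\<lambda>n. f ^^ n)"
      then have "\<forall>k. \<exists>n. s k = f ^^ n" by blast
      then obtain m where m: "\<And>k. s k = f ^^ m k" by metis
      have sf: "s k (f y) = (f ^^ Suc (m k)) y" for k y by (simp add: m funpow_swap1)
      have "range (\<lambda>k. f ^^ Suc (m k)) \<subseteq> range (\<lambda>n. f ^^ n)" by blast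
      from U(3)[unfolded normal_family_def, rule_format, OF this]
      obtain r g where rg: "strict_mono r" "g ` U \<subseteq> sphere 0 1"
        "locally_uniform_limit U (\<lambda>k. to_sphere \<circ> (f ^^ Suc (m (r k)))) g"
        by (elim exE conjE) (rule that)
      define g' where "g' y = lim (\<lambda>k. to_sphere (s (r k) y))" for y
      have g': "g' (f u) = g u" if "u \<in> U" for u
      proof -
        from bspec[OF rg(3)[unfolded locally_uniform_limit_def] that]
        obtain V where "u \<in> V" "uniform_limit V (\<lambda>k. to_sphere \<circ> (f ^^ Suc (m (r k)))) g sequentially"
          by (elim exE conjE) (rule that)
        then have "(\<lambda>k. (to_sphere \<circ> (f ^^ Suc (m (r k)))) u) \<longlonglongrightarrow> g u"
          by (rule tendsto_uniform_limitI[rotated])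
        then show ?thesis unfolding g'_def sf comp_def by (rule limI)
      qed
      have "locally_uniform_limit (f ` U) (\<lambda>k. to_sphere \<circ> s (r k)) g'"
        unfolding locally_uniform_limit_def
      proof
        fix y assume "y \<in> f ` U"
        then obtain u where u: "u \<in> U" "y = f u" by blast
        from bspec[OF rg(3)[unfolded locally_uniform_limit_def] u(1)]
        obtain V where V: "open V" "u \<in> V" "V \<subseteq> U"
          "uniform_limit V (\<lambda>k. to_sphere \<circ> (f ^^ Suc (m (r k)))) g sequentially"
          by (elim exE conjE) (rule that)
        have "uniform_limit (f ` V) (\<lambda>k. to_sphere \<circ> s (r k)) g' sequentially"
          unfolding uniform_limit_iff
        proof (intro allI impI)
          fix e :: real assume "e > 0"
          then have "\<forall>\<^sub>F k in sequentially. \<forall>u\<in>V. dist ((to_sphere \<circ> (f ^^ Suc (m (r k)))) u) (g u) < e"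
            using V(4) unfolding uniform_limit_iff by blast
          then show "\<forall>\<^sub>F k in sequentially. \<forall>y\<in>f ` V. dist ((to_sphere \<circ> s (r k)) y) (g' y) < e"
          proof (rule eventually_mono, intro ballI)
            fix k y assume k: "\<forall>u\<in>V. dist ((to_sphere \<circ> (f ^^ Suc (m (r k)))) u) (g u) < e" and "y \<in> f ` V"
            then obtain u' where u': "u' \<in> V" "y = f u'" by blast
            then have "g' y = g u'" using g' V(3) by blast
            then show "dist ((to_sphere \<circ> s (r k)) y) (g' y) < e"
              using bspec[OF k u'(1)] by (simp only: comp_def u'(2) sf)
          qed
        qed
        then show "\<exists>V. open V \<and> y \<in> V \<and> V \<subseteq> f ` U \<and>
            uniform_limit V (\<lambda>k. to_sphere \<circ> s (r k)) g' sequentially"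
          using V u op by (intro exI[of _ "f ` V"]) auto
      qed
      moreover have "g' ` f ` U \<subseteq> sphere 0 1"
        using rg(2) g' by auto
      ultimately show "\<exists>r g. strict_mono r \<and> g ` f ` U \<subseteq> sphere 0 1 \<and>
          locally_uniform_limit (f ` U) (\<lambda>k. to_sphere \<circ> s (r k)) g"
        using rg(1) by blast
    qed
    then show "f x \<in> fatou_set f" using op[OF U(1)] U(2) by (auto simp: fatou_set_def)
  qed
  then show ?thesis by (simp add: completely_invariant_def)
qed

lemma continuous_on_funpow:
  fixes f :: "'a::topological_space \<Rightarrow> 'a"
  assumes "continuous_on UNIV f"
  shows "continuous_on S (f ^^ n)"
proof (rule continuous_on_subset)
  show "continuous_on UNIV (f ^^ n)"
  proof (induction n)
    case (Suc n)
    then show ?case using continuous_on_compose2[OF assms Suc] by (simp add: comp_def)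
  qed (simp add: id_def)
qed simp

text \<open>A locally uniform limit of iterates near \<open>z\<close> is continuous into the sphere, equals \<open>\<infinity>\<close> at the escaping points
and the finite point \<open>a\<close> on \<open>B\<close>; both sets accumulate at \<open>z\<close>.\<close>

lemma not_in_fatou_set:
  assumes cont: "continuous_on UNIV f"
    and z: "z \<in> closure (escaping_set f)" "z \<in> closure B"
    and B: "\<And>w. w \<in> B \<Longrightarrow> (\<lambda>n. (f ^^ n) w) \<longlonglongrightarrow> a"
  shows "z \<notin> fatou_set f"
proof
  assume "z \<in> fatou_set f"
  then obtain U where U: "open U" "z \<in> U" "normal_family U (range (\<lambda>n. f ^^ n))"
    by (auto simp: fatou_set_def)
  obtain r g where rg: "strict_mono r" "locally_uniform_limit U (\<lambda>k. to_sphere \<circ> (f ^^ r k)) g"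
    using U(3)[unfolded normal_family_def, rule_format, of "\<lambda>k. f ^^ k"] by auto
  then obtain V where V: "open V" "z \<in> V" "uniform_limit V (\<lambda>k. to_sphere \<circ> (f ^^ r k)) g sequentially"
    using U(2) unfolding locally_uniform_limit_def by blast
  have lim: "(\<lambda>k. to_sphere ((f ^^ r k) w)) \<longlonglongrightarrow> g w" if "w \<in> V" for w
    using tendsto_uniform_limitI[OF V(3) that] by (simp add: comp_def)
  have r: "filterlim r at_top sequentially" using rg(1) by (rule filterlim_subseq)
  have "continuous_on V g"
    by (rule uniform_limit_theorem[OF always_eventually[OF allI] V(3)])
      (intro continuous_on_compose continuous_on_funpow cont to_sphere_continuous, simp)
  then have gz: "isCont g z" using V(1,2) by (simp add: continuous_on_eq_continuous_at)
  have limit_value: "g z = c" if S: "z \<in> closure S" "\<And>w. w \<in> S \<Longrightarrow> w \<in> V \<Longrightarrow> g w = c" for S c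
  proof -
    obtain x where x: "\<And>n. x n \<in> S" "x \<longlonglongrightarrow> z" using S(1) closure_sequential by blast
    have "(\<lambda>n. g (x n)) \<longlonglongrightarrow> g z" by (rule isCont_tendsto_compose[OF gz x(2)])
    moreover have "eventually (\<lambda>n. x n \<in> V) sequentially" using topological_tendstoD[OF x(2) V(1,2)] .
    then have "eventually (\<lambda>n. g (x n) = c) sequentially" by (rule eventually_mono) (use S(2) x(1) in blast)
    then have "(\<lambda>n. g (x n)) \<longlonglongrightarrow> c" by (rule tendsto_eventually)
    ultimately show ?thesis by (rule LIMSEQ_unique)
  qed
  have "g z = (0, 1)"
  proof (rule limit_value[OF z(1)])
    fix w assume w: "w \<in> escaping_set f" "w \<in> V"
    have "filterlim (\<lambda>k. (f ^^ r k) w) at_infinity sequentially"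
      using filterlim_compose[OF _ r] w(1) unfolding escaping_set_def by blast
    then show "g w = (0, 1)"
      using tendsto_to_sphere_at_infinity LIMSEQ_unique[OF lim[OF w(2)]] by blast
  qed
  moreover have "g z = to_sphere a"
  proof (rule limit_value[OF z(2)])
    fix w assume w: "w \<in> B" "w \<in> V"
    have "(\<lambda>k. (f ^^ r k) w) \<longlonglongrightarrow> a" using filterlim_compose[OF B[OF w(1)] r] .
    then have "(\<lambda>k. to_sphere ((f ^^ r k) w)) \<longlonglongrightarrow> to_sphere a"
      by (rule continuous_on_tendsto_compose[OF to_sphere_continuous[of UNIV]]) auto
    then show "g w = to_sphere a" using LIMSEQ_unique[OF lim[OF w(2)]] by blast
  qed
  moreover have "to_sphere a \<noteq> (0, 1)"
  proof
    assume "to_sphere a = (0, 1)"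
    then have "(norm a)\<^sup>2 - 1 = (norm a)\<^sup>2 + 1 \<or> (norm a)\<^sup>2 + 1 = 0"
      by (auto simp: to_sphere_def divide_eq_eq split: if_splits)
    then show False using zero_le_power2[of "norm a"] by linarith
  qed
  ultimately show False by simp
qed

text \<open>A connected set that leaves \<open>B\<close> has to cross its frontier.\<close>

lemma connected_in_components_if_frontier_disjoint:
  assumes "connected B" "B \<noteq> {}" "B \<subseteq> U" "frontier B \<inter> U = {}"
  shows "B \<in> components U"
proof -
  obtain b where b: "b \<in> B" using assms(2) by blast
  let ?C = "connected_component_set U b"
  have "B \<subseteq> ?C" using connected_component_maximal[OF b assms(1,3)] .
  moreover have "?C \<subseteq> B"
  proof (rule ccontr)
    assume "\<not> ?C \<subseteq> B"
    then have "?C \<inter> frontier B \<noteq> {}"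
      using connected_Int_frontier[OF connected_connected_component] \<open>B \<subseteq> ?C\<close> b by blast
    then show False using connected_component_subset[of U b] assms(4) by blast
  qed
  ultimately have "B = ?C" by blast
  then show ?thesis using b assms(3) by (auto intro: componentsI)
qed

lemma wandering_componentI:
  assumes "open U" "completely_invariant f U"
    and "\<And>n. B n \<in> components U" "\<And>n. f ` B n \<subseteq> B (Suc n)" "inj B"
  shows "wandering_component f U (B 0)"
proof -
  have "(f ^^ n) ` B 0 \<subseteq> B n" for n
  proof (induction n)
    case (Suc n)
    have "(f ^^ Suc n) ` B 0 = f ` (f ^^ n) ` B 0" by (simp add: image_comp)
    also have "\<dots> \<subseteq> B (Suc n)" using Suc assms(4)[of n] by blast
    finally show ?case .
  qed simp
  then show ?thesis
    unfolding wandering_component_def using assms injD[OF assms(5)] by blast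
qed

section \<open>Escaping points\<close>

text \<open>At distance 25 the quintic term is more than nine times the identity, which outweighs the contraction by \<open>1/2\<close>.\<close>

lemma wander_norm_far:
  assumes "25 \<le> norm v"
  shows "2 * norm v \<le> norm (wander v)"
proof -
  let ?z = "to_cx v"
  have n2: "25\<^sup>2 \<le> (norm v)\<^sup>2" by (rule power_mono[OF assms]) simp
  have n4: "25 ^ 4 \<le> norm v ^ 4" by (rule power_mono[OF assms]) simp
  have w: "wander v = stretch (?z + ?z ^ 5 / 40000)"
    using n2 by (simp add: wander_stretch_perturb perturb_far)
  have s: "norm z / 2 \<le> norm (stretch z)" for z
  proof (rule power2_le_imp_le)
    show "(norm z / 2)\<^sup>2 \<le> (norm (stretch z))\<^sup>2"
      by (simp add: norm_plane_sq stretch_def power_divide cmod_power2 power_mult_distrib field_simps)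
  qed simp
  have "4 * norm v \<le> norm v ^ 5 / 40000 - norm v"
  proof -
    have "norm v * 25 ^ 4 \<le> norm v * norm v ^ 4" by (rule mult_left_mono[OF n4]) simp
    then have "norm v * 390625 \<le> norm v ^ 5" by (simp add: eval_nat_numeral)
    then show ?thesis using norm_ge_zero[of v] by linarith
  qed
  also have "\<dots> = norm (?z ^ 5 / 40000) - norm ?z" by (simp add: norm_divide norm_power)
  also have "\<dots> \<le> norm (?z + ?z ^ 5 / 40000)"
    using norm_diff_ineq[of "?z ^ 5 / 40000" ?z] by (simp add: add.commute)
  also have "\<dots> \<le> 2 * norm (wander v)"
    using s[of "?z + ?z ^ 5 / 40000"] by (simp add: w)
  finally show ?thesis by simp
qed

lemma escaping_setI:
  assumes "\<And>n. c * q ^ n \<le> norm ((f ^^ n) x)" "0 < c" "1 < q"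
  shows "x \<in> escaping_set f"
proof -
  have "filterlim (\<lambda>n. norm (q ^ n)) at_top sequentially"
    using filterlim_realpow_sequentially_gt1[of q] assms(3)
    by (simp only: filterlim_at_infinity_conv_norm_at_top[symmetric]) simp
  then have q: "filterlim (\<lambda>n. q ^ n) at_top sequentially"
    using assms(3) by (simp add: norm_power)
  have "filterlim (\<lambda>n. c * q ^ n) at_top sequentially"
    by (rule filterlim_tendsto_pos_mult_at_top[OF tendsto_const assms(2) q])
  then have "filterlim (\<lambda>n. norm ((f ^^ n) x)) at_top sequentially"
    by (rule filterlim_at_top_mono) (use assms(1) in simp)
  then show ?thesis
    unfolding escaping_set_def by (simp add: filterlim_at_infinity_conv_norm_at_top)
qed

lemma escaping_far:
  assumes "25 \<le> norm v"
  shows "v \<in> escaping_set wander"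
proof (rule escaping_setI[of 25 2])
  show "25 * 2 ^ n \<le> norm ((wander ^^ n) v)" for n
  proof (induction n)
    case (Suc n)
    have "25 * 1 \<le> 25 * (2::real) ^ n" by (intro mult_left_mono) auto
    then have "2 * norm ((wander ^^ n) v) \<le> norm (wander ((wander ^^ n) v))"
      using Suc by (intro wander_norm_far) linarith
    then show ?case using Suc by simp
  qed (use assms in simp)
qed auto

lemma open_escaping_set: "open (escaping_set wander)"
proof -
  have "escaping_set wander = (\<Union>n. (wander ^^ n) -` {v. 25 < norm v})"
  proof (intro set_eqI iffI)
    fix x assume "x \<in> escaping_set wander"
    then have "filterlim (\<lambda>n. norm ((wander ^^ n) x)) at_top sequentially"
      unfolding escaping_set_def by (simp add: filterlim_at_infinity_conv_norm_at_top)
    then have "eventually (\<lambda>n. 25 < norm ((wander ^^ n) x)) sequentially"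
      by (simp add: filterlim_at_top_dense)
    then show "x \<in> (\<Union>n. (wander ^^ n) -` {v. 25 < norm v})"
      by (auto simp: eventually_sequentially)
  next
    fix x assume "x \<in> (\<Union>n. (wander ^^ n) -` {v. 25 < norm v})"
    then obtain n where "(wander ^^ n) x \<in> escaping_set wander"
      by (auto intro: escaping_far less_imp_le)
    then show "x \<in> escaping_set wander" by (simp only: funpow_in_escaping_set)
  qed
  moreover have "open ((wander ^^ n) -` {v. 25 < norm v})" for n
    by (intro open_vimage open_Collect_less continuous_intros continuous_on_funpow continuous_on_wander)
  ultimately show ?thesis by auto
qed

lemma filterlim_wander_at_infinity: "filterlim wander at_infinity at_infinity"
  unfolding filterlim_at_infinity_conv_norm_at_top
proof (rule filterlim_at_top_mono)
  show "filterlim norm at_top (at_infinity :: plane filter)" by (rule filterlim_norm_at_top)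
  show "eventually (\<lambda>v. norm v \<le> norm (wander v)) at_infinity"
    unfolding eventually_at_infinity
  proof (intro exI allI impI)
    fix v :: plane assume "25 \<le> norm v"
    then show "norm v \<le> norm (wander v)" using wander_norm_far[of v] norm_ge_zero[of v] by linarith
  qed
qed

text \<open>The identity \<open>\<i> ^ 5 = \<i>\<close> makes the quintic term point away from the origin on the imaginary axis.\<close>

lemma wander_vertical:
  assumes "v$1 = 0"
  shows "wander v $ 1 = 0" "5/4 * \<bar>v$2\<bar> \<le> \<bar>wander v $ 2\<bar>"
proof -
  define c where "c = cutoff ((norm v)\<^sup>2) / 40000"
  have c: "c \<ge> 0" using cutoff_bounds by (simp add: c_def)
  have z: "to_cx v = \<i> * of_real (v$2)" using assms by (simp add: complex_eq_iff)
  have "\<i> ^ 5 = \<i>" by (simp add: eval_nat_numeral)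
  then have "perturb (to_cx v) = \<i> * of_real (v$2 + c * (v$2) ^ 5)"
    unfolding perturb_def norm_to_cx c_def[symmetric]
    by (simp add: z power_mult_distrib c_def algebra_simps)
  then have p: "Re (perturb (to_cx v)) = 0" "Im (perturb (to_cx v)) = v$2 * (1 + c * (v$2) ^ 4)"
    by (simp_all add: algebra_simps eval_nat_numeral)
  show "wander v $ 1 = 0" by (simp add: wander_nth p)
  have "bead_height (v$1) = 0" using assms by (simp add: bead_height_def)
  then have "tent (bead_height (v$1)) (v$2) = 0" by (simp add: tent_outside)
  then have "\<bar>wander v $ 2\<bar> = 5/4 * (\<bar>v$2\<bar> * \<bar>1 + c * (v$2) ^ 4\<bar>)"
    by (simp add: wander_nth p abs_mult)
  moreover have "\<bar>v$2\<bar> * 1 \<le> \<bar>v$2\<bar> * \<bar>1 + c * (v$2) ^ 4\<bar>"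
    using c by (intro mult_left_mono) auto
  ultimately show "5/4 * \<bar>v$2\<bar> \<le> \<bar>wander v $ 2\<bar>" by simp
qed

lemma escaping_vertical:
  assumes "v$1 = 0" "v$2 \<noteq> 0"
  shows "v \<in> escaping_set wander"
proof (rule escaping_setI[of "\<bar>v$2\<bar>" "5/4"])
  have *: "(wander ^^ n) v $ 1 = 0 \<and> \<bar>v$2\<bar> * (5/4) ^ n \<le> \<bar>(wander ^^ n) v $ 2\<bar>" for n
  proof (induction n)
    case (Suc n)
    then show ?case using wander_vertical[of "(wander ^^ n) v"] by auto
  qed (use assms in simp)
  show "\<bar>v$2\<bar> * (5/4) ^ n \<le> norm ((wander ^^ n) v)" for n
    using *[of n] component_le_norm_cart[of "(wander ^^ n) v" 2] by linarith
qed (use assms in auto)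

section \<open>The chain of beads\<close>

lemma wander_near:
  assumes "\<bar>v$1\<bar> \<le> 1" "\<bar>v$2\<bar> \<le> 1"
  shows "wander v = pt (v$1 / 2) (5/4 * v$2 - 3/4 * tent (bead_height (v$1)) (v$2))"
proof -
  have "(v$1)\<^sup>2 \<le> 1" "(v$2)\<^sup>2 \<le> 1" using assms by (simp_all add: abs_square_le_1)
  then have "(norm (to_cx v))\<^sup>2 \<le> 2" by (simp add: norm_plane_sq)
  then show ?thesis by (simp add: plane_eq_iff wander_nth perturb_near)
qed

text \<open>The beads with their boundaries, up to the abscissa 1, together with their limit point 0 and the segment of the horizontal axis from \<open>-1\<close> to 0, on which the height is 0.
On this whole set the map is the homothety with factor \<open>1/2\<close>.\<close>

definition bead_chain :: "plane set" where
  "bead_chain = {v. - 1 \<le> v$1 \<and> v$1 < 1 \<and> \<bar>v$2\<bar> \<le> bead_height (v$1)}"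

lemma wander_bead_chain:
  assumes "v \<in> bead_chain"
  shows "wander v = (1/2) *\<^sub>R v" "(1/2) *\<^sub>R v \<in> bead_chain"
proof -
  have v: "- 1 \<le> v$1" "v$1 < 1" "\<bar>v$2\<bar> \<le> bead_height (v$1)"
    using assms by (auto simp: bead_chain_def)
  then have "\<bar>v$1\<bar> \<le> 1" "\<bar>v$2\<bar> \<le> 1" using bead_height_bound[of "v$1"] by linarith+
  then show "wander v = (1/2) *\<^sub>R v"
    using v by (simp add: wander_near tent_inside plane_eq_iff)
  show "(1/2) *\<^sub>R v \<in> bead_chain"
    using v bead_height_half[of "v$1"] by (auto simp: bead_chain_def)
qed

lemma funpow_wander_bead_chain:
  assumes "v \<in> bead_chain"
  shows "(wander ^^ n) v = (1/2) ^ n *\<^sub>R v" "(wander ^^ n) v \<in> bead_chain"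
proof -
  have "(wander ^^ n) v = (1/2) ^ n *\<^sub>R v \<and> (wander ^^ n) v \<in> bead_chain"
  proof (induction n)
    case (Suc n)
    have "(wander ^^ Suc n) v = (1/2) *\<^sub>R (wander ^^ n) v"
      by (simp only: funpow.simps comp_apply wander_bead_chain(1)[OF conjunct2[OF Suc]])
    then show ?case
      using wander_bead_chain(2)[OF conjunct2[OF Suc]] conjunct1[OF Suc] by simp
  qed (use assms in simp)
  then show "(wander ^^ n) v = (1/2) ^ n *\<^sub>R v" "(wander ^^ n) v \<in> bead_chain" by auto
qed

lemma bead_chain_tendsto_0:
  assumes "v \<in> bead_chain"
  shows "(\<lambda>n. (wander ^^ n) v) \<longlonglongrightarrow> 0"
proof -
  have "(\<lambda>n. (1/2) ^ n *\<^sub>R v) \<longlonglongrightarrow> 0 *\<^sub>R v"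
    by (intro tendsto_intros LIMSEQ_power_zero) simp
  then show ?thesis by (simp add: funpow_wander_bead_chain[OF assms])
qed

lemma bead_chain_not_escaping:
  assumes "v \<in> bead_chain"
  shows "v \<notin> escaping_set wander"
proof
  assume "v \<in> escaping_set wander"
  then show False
    using bead_chain_tendsto_0[OF assms] not_tendsto_and_filterlim_at_infinity[OF sequentially_bot]
    unfolding escaping_set_def by blast
qed

lemma wander_excess:
  assumes "0 < v$1" "v$1 < 1" "bead_height (v$1) < \<bar>v$2\<bar>" "\<bar>v$2\<bar> \<le> 1"
  shows "wander v $ 1 = v$1 / 2"
    and "5/4 * (\<bar>v$2\<bar> - bead_height (v$1)) \<le> \<bar>wander v $ 2\<bar> - bead_height (wander v $ 1)"
    and "\<bar>wander v $ 2\<bar> \<le> 5/4 * \<bar>v$2\<bar>"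
proof -
  have w: "wander v = pt (v$1 / 2) (5/4 * v$2 - 3/4 * tent (bead_height (v$1)) (v$2))"
    using assms by (intro wander_near) auto
  show 1: "wander v $ 1 = v$1 / 2" by (simp add: w)
  show "5/4 * (\<bar>v$2\<bar> - bead_height (v$1)) \<le> \<bar>wander v $ 2\<bar> - bead_height (wander v $ 1)"
    unfolding 1 bead_height_half[OF assms(2)]
    using tent_excess(1)[OF bead_height_nonneg assms(3)]
    unfolding w pt_simps by (simp only: le_diff_eq add.commute)
  show "\<bar>wander v $ 2\<bar> \<le> 5/4 * \<bar>v$2\<bar>"
    using tent_excess(2)[OF bead_height_nonneg assms(3)] by (simp add: w)
qed

text \<open>As long as the orbit stays in the strip, its excess over the chain grows geometrically, so it has to leave.
It cannot jump over \<open>[1/4, 1/2]\<close>, because one step enlarges the ordinate at most by the factor \<open>5/4\<close>.\<close>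

lemma exit_strip:
  assumes v: "0 < v$1" "v$1 < 1" "bead_height (v$1) < \<bar>v$2\<bar>" "\<bar>v$2\<bar> < 1/4"
  obtains n where "\<bar>(wander ^^ n) v $ 1\<bar> \<le> v$1" "1/4 \<le> \<bar>(wander ^^ n) v $ 2\<bar>" "\<bar>(wander ^^ n) v $ 2\<bar> \<le> 1/2"
proof -
  define e where "e = \<bar>v$2\<bar> - bead_height (v$1)"
  have e: "e > 0" using v by (simp add: e_def)
  define P where "P n \<longleftrightarrow> 0 < (wander ^^ n) v $ 1 \<and> (wander ^^ n) v $ 1 \<le> v$1 \<and>
    (5/4) ^ n * e \<le> \<bar>(wander ^^ n) v $ 2\<bar> - bead_height ((wander ^^ n) v $ 1)" for n
  have step: "P (Suc n) \<and> \<bar>(wander ^^ Suc n) v $ 2\<bar> \<le> 1/2"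
    if "P n" "\<bar>(wander ^^ n) v $ 2\<bar> < 1/4" for n
  proof -
    let ?w = "(wander ^^ n) v"
    have "0 < (5/4) ^ n * e" using e by simp
    then have w: "0 < ?w$1" "?w$1 < 1" "bead_height (?w$1) < \<bar>?w$2\<bar>" "\<bar>?w$2\<bar> \<le> 1"
      using that v(2) unfolding P_def by linarith+
    have "5/4 * ((5/4) ^ n * e) \<le> 5/4 * (\<bar>?w$2\<bar> - bead_height (?w$1))"
      by (rule mult_left_mono) (use that(1) in \<open>auto simp: P_def\<close>)
    then show ?thesis
      using wander_excess[OF w] that unfolding P_def by auto
  qed
  have P0: "P 0" using v by (simp add: P_def e_def)
  have "\<exists>n. \<not> \<bar>(wander ^^ n) v $ 2\<bar> < 1/4"
  proof (rule ccontr)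
    assume "\<not> ?thesis"
    then have small: "\<And>n. \<bar>(wander ^^ n) v $ 2\<bar> < 1/4" by blast
    have "P n" for n by (induction n) (use P0 step small in auto)
    then have lt: "(5/4) ^ n * e < 1/4" for n
      using small[of n] bead_height_nonneg[of "(wander ^^ n) v $ 1"] unfolding P_def
      by (meson diff_le_eq le_add_same_cancel1 le_less_trans order_trans)
    obtain n where "1 / (4 * e) < (5/4) ^ n" using real_arch_pow[of "5/4"] by auto
    then show False using e lt[of n] by (simp add: field_simps)
  qed
  then obtain n where n: "\<not> \<bar>(wander ^^ n) v $ 2\<bar> < 1/4" "\<And>m. m < n \<Longrightarrow> \<bar>(wander ^^ m) v $ 2\<bar> < 1/4"
    using exists_least_iff[of "\<lambda>n. \<not> \<bar>(wander ^^ n) v $ 2\<bar> < 1/4"] by blast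
  have Pn: "P m" if "m \<le> n" for m
    using that by (induction m) (use P0 step n(2) in auto)
  have "n \<noteq> 0" using n(1) v(4) by (cases n) auto
  then obtain m where m: "n = Suc m" by (cases n) auto
  show ?thesis
    by (rule that[of n]) (use Pn[of n] step[of m] Pn[of m] n m in \<open>auto simp: P_def\<close>)
qed

text \<open>Compactness of two segments of the vertical axis inside the open escaping set.\<close>

lemma escaping_near_axis:
  obtains d where "0 < d" "\<And>v. \<bar>v$1\<bar> < d \<Longrightarrow> 1/4 \<le> \<bar>v$2\<bar> \<Longrightarrow> \<bar>v$2\<bar> \<le> 1/2 \<Longrightarrow> v \<in> escaping_set wander"
proof -
  define K where "K = (\<lambda>t. pt 0 t) ` ({-1/2..-1/4} \<union> {1/4..1/2})"
  have eq: "(\<lambda>t. t *\<^sub>R pt 0 1) = pt 0" by (rule ext) (simp add: plane_eq_iff)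
  have "continuous_on S (\<lambda>t. t *\<^sub>R pt 0 1)" for S by (intro continuous_intros)
  then have "compact K"
    unfolding K_def eq by (intro compact_continuous_image compact_Un) auto
  moreover have "K \<subseteq> escaping_set wander"
    unfolding K_def by (auto intro!: escaping_vertical)
  ultimately obtain d where d: "0 < d" "(\<Union>x\<in>K. ball x d) \<subseteq> escaping_set wander"
    using compact_subset_open_imp_ball_epsilon_subset[OF _ open_escaping_set] by blast
  have "v \<in> escaping_set wander" if v: "\<bar>v$1\<bar> < d" "1/4 \<le> \<bar>v$2\<bar>" "\<bar>v$2\<bar> \<le> 1/2" for v
  proof -
    have "pt 0 (v$2) \<in> K"
      unfolding K_def using v by (intro imageI) (auto simp: abs_if split: if_splits)
    moreover have "norm (pt 0 (v$2) - v) \<le> \<bar>v$1\<bar>"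
      using norm_plane_le[of "pt 0 (v$2) - v"] by simp
    then have "v \<in> ball (pt 0 (v$2)) d" using v(1) by (simp add: dist_norm)
    ultimately show ?thesis using d(2) by blast
  qed
  then show ?thesis using that d(1) by blast
qed

text \<open>By continuity, points close to \<open>z\<close> follow the orbit of \<open>z\<close>, which remains in the chain, for \<open>N\<close> steps. After that
their abscissa is below \<open>(1/2) ^ N < d\<close>, and it only decreases until they leave the strip; so those outside
the chain leave it within distance \<open>d\<close> of the vertical axis.\<close>

lemma escaping_near_chain:
  assumes z: "0 < z$1" "z$1 < 1" "\<bar>z$2\<bar> \<le> bead_height (z$1)"
  obtains U where "open U" "z \<in> U"
    "\<And>v. v \<in> U \<Longrightarrow> 0 < v$1 \<and> v$1 < 1"
    "\<And>v. v \<in> U \<Longrightarrow> bead_height (v$1) < \<bar>v$2\<bar> \<Longrightarrow> v \<in> escaping_set wander"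
proof -
  obtain d where d: "0 < d" "\<And>v. \<bar>v$1\<bar> < d \<Longrightarrow> 1/4 \<le> \<bar>v$2\<bar> \<Longrightarrow> \<bar>v$2\<bar> \<le> 1/2 \<Longrightarrow> v \<in> escaping_set wander"
    using escaping_near_axis by blast
  obtain N where N: "(1/2) ^ N < d" using real_arch_pow_inv[OF d(1), of "1/2"] by auto
  define S where "S = {v::plane. 0 < v$1 \<and> v$1 < 1 \<and> \<bar>v$2\<bar> < 1/4}"
  have S: "open S" unfolding S_def by (intro open_Collect_conj open_Collect_less continuous_intros)
  define U where "U = (\<Inter>j\<le>N. (wander ^^ j) -` S)"
  have U0: "v \<in> S" if "v \<in> U" for v
    using that unfolding U_def by (auto dest: bspec[of _ _ 0])
  show ?thesis
  proof (rule that[of U])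
    show "open U"
      unfolding U_def by (intro open_INT ballI open_vimage S continuous_on_funpow continuous_on_wander) auto
    have zc: "z \<in> bead_chain" using z by (auto simp: bead_chain_def)
    have "(wander ^^ j) z \<in> S" for j
    proof -
      have "(1/2) ^ j * z$1 \<le> 1 * z$1"
        using z(1) by (intro mult_right_mono power_le_one) auto
      then have "(1/2) ^ j * z$1 < 1" using z(2) by linarith
      moreover have "\<bar>((wander ^^ j) z) $ 2\<bar> \<le> 1/100"
        using funpow_wander_bead_chain(2)[OF zc, of j] bead_height_bound[of "(wander ^^ j) z $ 1"]
        unfolding bead_chain_def by auto
      ultimately show ?thesis
        using z funpow_wander_bead_chain(1)[OF zc, of j] by (auto simp: S_def)
    qed
    then show "z \<in> U" by (simp add: U_def)
    show "0 < v$1 \<and> v$1 < 1" if "v \<in> U" for v using U0[OF that] by (auto simp: S_def)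
    fix v assume v: "v \<in> U" "bead_height (v$1) < \<bar>v$2\<bar>"
    have inv: "(wander ^^ j) v $ 1 = (1/2) ^ j * v$1 \<and> bead_height ((wander ^^ j) v $ 1) < \<bar>(wander ^^ j) v $ 2\<bar>"
      if "j \<le> N" for j
      using that
    proof (induction j)
      case (Suc j)
      let ?w = "(wander ^^ j) v"
      have w: "?w \<in> S" "bead_height (?w$1) < \<bar>?w$2\<bar>" "?w$1 = (1/2) ^ j * v$1"
        using Suc v(1) by (auto simp: U_def)
      then have e: "0 < ?w$1" "?w$1 < 1" "\<bar>?w$2\<bar> \<le> 1" by (auto simp: S_def)
      show ?case
        using wander_excess(1,2)[OF e(1,2) w(2) e(3)] w(2,3) by auto
    qed (use v in simp)
    let ?w = "(wander ^^ N) v"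
    have w: "?w \<in> S" using v(1) by (auto simp: U_def)
    have h: "0 < ?w$1" "?w$1 < 1" "bead_height (?w$1) < \<bar>?w$2\<bar>" "\<bar>?w$2\<bar> < 1/4"
      using w inv[of N] by (auto simp: S_def)
    have "?w$1 \<le> (1/2) ^ N"
      using inv[of N] U0[OF v(1)] by (simp add: S_def mult_left_le)
    then have wd: "?w$1 < d" using N by simp
    obtain n where n: "\<bar>(wander ^^ n) ?w $ 1\<bar> \<le> ?w$1" "1/4 \<le> \<bar>(wander ^^ n) ?w $ 2\<bar>" "\<bar>(wander ^^ n) ?w $ 2\<bar> \<le> 1/2"
      using exit_strip[OF h] by blast
    then have "(wander ^^ n) ?w \<in> escaping_set wander" using wd by (intro d(2)) auto
    then show "v \<in> escaping_set wander" by (simp only: funpow_in_escaping_set)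
  qed
qed

lemma chain_boundary_in_closure_escaping:
  assumes z: "0 < z$1" "z$1 < 1" "\<bar>z$2\<bar> = bead_height (z$1)"
  shows "z \<in> closure (escaping_set wander)"
proof -
  obtain U where U: "open U" "z \<in> U"
    "\<And>v. v \<in> U \<Longrightarrow> bead_height (v$1) < \<bar>v$2\<bar> \<Longrightarrow> v \<in> escaping_set wander"
    using escaping_near_chain[of z] z by (metis order_refl)
  define s where "s = (if 0 \<le> z$2 then 1 else - 1 :: real)"
  define x where "x n = z + (1 / real (Suc n)) *\<^sub>R pt 0 s" for n
  have "(\<lambda>n. z + (1 / real (Suc n)) *\<^sub>R pt 0 s) \<longlonglongrightarrow> z + 0 *\<^sub>R pt 0 s"
    by (intro tendsto_intros LIMSEQ_Suc[OF lim_1_over_n])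
  then have x: "x \<longlonglongrightarrow> z" by (simp add: x_def[abs_def])
  then have "eventually (\<lambda>n. x n \<in> U) sequentially" using U(1,2) by (rule topological_tendstoD)
  moreover have "bead_height (x n $ 1) < \<bar>x n $ 2\<bar>" for n
  proof -
    define c where "c = 1 / real (Suc n)"
    have "0 < c" by (simp add: c_def)
    then have "\<bar>z$2 + c * s\<bar> = \<bar>z$2\<bar> + c" by (simp add: s_def)
    moreover have "x n $ 1 = z$1" "x n $ 2 = z$2 + c * s" by (simp_all add: x_def c_def)
    ultimately show ?thesis using z(3) \<open>0 < c\<close> by simp
  qed
  ultimately have "eventually (\<lambda>n. x n \<in> escaping_set wander) sequentially"
    by (auto elim!: eventually_mono intro: U(3))
  then obtain N where "\<And>n. x (n + N) \<in> escaping_set wander"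
    unfolding eventually_sequentially by (metis le_add2)
  then show ?thesis
    unfolding closure_sequential using LIMSEQ_ignore_initial_segment[OF x, of N]
    by (intro exI[of _ "\<lambda>n. x (n + N)"]) simp
qed

section \<open>Wandering components\<close>

text \<open>The exponents start at 1, so that the first bead together with its boundary lies in \<open>0 < x < 1\<close>.\<close>

definition bead :: "nat \<Rightarrow> plane set" where
  "bead n = {v. (1/2) ^ (n + 2) < v$1 \<and> v$1 < (1/2) ^ (n + 1) \<and> \<bar>v$2\<bar> < bead_height (v$1)}"

lemma bead_subset_chain: "bead n \<subseteq> bead_chain"
proof
  fix v assume "v \<in> bead n"
  moreover have "(0::real) < (1/2) ^ (n + 2)" by simp
  moreover have "(1/2) ^ (n + 1) \<le> (1::real)" by (rule power_le_one) auto
  ultimately show "v \<in> bead_chain" unfolding bead_def bead_chain_def by fastforce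
qed

lemma open_bead: "open (bead n)"
  unfolding bead_def
  by (intro open_Collect_conj open_Collect_less continuous_intros
      continuous_on_compose2[OF continuous_on_bead_height[of UNIV]]) auto

lemma bead_nonempty: "pt (3/4 * (1/2) ^ (n + 1)) 0 \<in> bead n"
proof -
  have "0 < bead_height (3/4 * (1/2) ^ (n + 1))"
    by (rule bead_height_pos[of "n + 1"]) (auto simp: field_simps)
  then show ?thesis by (auto simp: bead_def field_simps)
qed

text \<open>A bead is a rectangle, rescaled vertically by the positive height.\<close>

lemma connected_bead: "connected (bead n)"
proof -
  let ?f = "\<lambda>v::plane. pt (v$1) (v$2 * bead_height (v$1))"
  let ?Q = "box (pt ((1/2) ^ (n + 2)) (- 1)) (pt ((1/2) ^ (n + 1)) 1)"
  have "bead n = ?f ` ?Q"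
  proof (intro set_eqI iffI)
    fix v assume v: "v \<in> bead n"
    then have b: "bead_height (v$1) > 0" by (auto simp: bead_def)
    have "\<bar>v$2 / bead_height (v$1)\<bar> < 1" using v b by (simp add: bead_def)
    then have "- 1 < v$2 / bead_height (v$1)" "v$2 / bead_height (v$1) < 1" by linarith+
    then show "v \<in> ?f ` ?Q"
      using v b by (intro image_eqI[of _ _ "pt (v$1) (v$2 / bead_height (v$1))"])
        (auto simp: plane_eq_iff mem_box_cart forall_2 bead_def abs_less_iff)
  next
    fix v assume "v \<in> ?f ` ?Q"
    then obtain w where w: "w \<in> ?Q" "v = ?f w" by blast
    then have x: "(1/2) ^ (n + 2) < w$1" "w$1 < (1/2) ^ (n + 1)" "\<bar>w$2\<bar> < 1"
      by (auto simp: mem_box_cart forall_2 abs_less_iff)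
    have "0 < bead_height (w$1)" by (rule bead_height_pos[of "n + 1"]) (use x in auto)
    then have "\<bar>w$2\<bar> * bead_height (w$1) < 1 * bead_height (w$1)"
      using x(3) by (intro mult_strict_right_mono)
    then show "v \<in> bead n" using x w(2) bead_height_nonneg[of "w$1"] by (simp add: bead_def abs_mult)
  qed
  moreover have "continuous_on ?Q ?f"
    unfolding pt_eq[of "_ $ 1"]
    by (intro continuous_intros continuous_on_compose2[OF continuous_on_bead_height[of UNIV]]) auto
  moreover have "connected ?Q" by (intro convex_connected convex_box)
  ultimately show ?thesis by (simp add: connected_continuous_image)
qed

text \<open>At the two ends of a bead the height vanishes, hence also there \<open>\<bar>y\<bar>\<close> equals the height.\<close>

lemma frontier_bead:
  assumes "z \<in> frontier (bead n)"
  shows "0 < z$1" "z$1 < 1" "\<bar>z$2\<bar> = bead_height (z$1)"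
proof -
  let ?C = "{v::plane. (1/2) ^ (n + 2) \<le> v$1 \<and> v$1 \<le> (1/2) ^ (n + 1) \<and> \<bar>v$2\<bar> \<le> bead_height (v$1)}"
  have "closed ?C"
    by (intro closed_Collect_conj closed_Collect_le continuous_intros
        continuous_on_compose2[OF continuous_on_bead_height[of UNIV]]) auto
  moreover have "bead n \<subseteq> ?C" by (auto simp: bead_def)
  ultimately have "z \<in> ?C" using assms closure_minimal unfolding frontier_def by blast
  moreover have "z \<notin> bead n"
    using assms open_bead by (simp add: frontier_def interior_open)
  ultimately have z: "(1/2) ^ (n + 2) \<le> z$1" "z$1 \<le> (1/2) ^ (n + 1)" "\<bar>z$2\<bar> \<le> bead_height (z$1)"
    and b: "z$1 = (1/2) ^ (n + 2) \<or> z$1 = (1/2) ^ (n + 1) \<or> \<bar>z$2\<bar> = bead_height (z$1)"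
    by (auto simp: bead_def)
  have "bead_height (z$1) = 0 \<or> \<bar>z$2\<bar> = bead_height (z$1)"
    using b by (metis bead_height_dyadic)
  then show "\<bar>z$2\<bar> = bead_height (z$1)" using z(3) by auto
  show "0 < z$1" using z(1) by (rule less_le_trans[rotated]) simp
  have "(1/2) ^ (n + 1) < (1::real)" using power_strict_decreasing[of 0 "n + 1" "1/2 :: real"] by simp
  then show "z$1 < 1" using z(2) by linarith
qed

lemma wander_bead: "wander ` bead n \<subseteq> bead (Suc n)"
proof
  fix w assume "w \<in> wander ` bead n"
  then obtain v where v: "v \<in> bead n" "w = wander v" by blast
  have w: "w = (1/2) *\<^sub>R v"
    using wander_bead_chain(1) bead_subset_chain v by blast
  have "v$1 < 1" using v(1) bead_subset_chain by (auto simp: bead_chain_def)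
  then show "w \<in> bead (Suc n)"
    using v(1) bead_height_half[of "v$1"] by (simp add: bead_def w)
qed

lemma inj_bead: "inj bead"
proof (rule linorder_injI)
  fix m n :: nat assume "m < n"
  have "pt (3/4 * (1/2) ^ (n + 1)) 0 \<notin> bead m"
  proof
    assume "pt (3/4 * (1/2) ^ (n + 1)) 0 \<in> bead m"
    then have "(1/2) ^ (m + 2) < 3/4 * (1/2 :: real) ^ (n + 1)" by (simp add: bead_def)
    also have "\<dots> < (1/2) ^ (n + 1)" by simp
    also have "\<dots> \<le> (1/2) ^ (m + 2)" using \<open>m < n\<close> by (intro power_decreasing) auto
    finally show False by simp
  qed
  then show "bead m \<noteq> bead n" using bead_nonempty by metis
qed

lemma bead_component_closure: "bead n \<in> components (UNIV - closure (escaping_set wander))"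
proof (rule connected_in_components_if_frontier_disjoint[OF connected_bead])
  show "bead n \<noteq> {}" using bead_nonempty by blast
  have "bead n \<inter> escaping_set wander = {}" using bead_subset_chain bead_chain_not_escaping by blast
  then have "bead n \<inter> closure (escaping_set wander) = {}"
    using open_Int_closure_eq_empty[OF open_bead] by blast
  then show "bead n \<subseteq> UNIV - closure (escaping_set wander)" by blast
  show "frontier (bead n) \<inter> (UNIV - closure (escaping_set wander)) = {}"
    using frontier_bead chain_boundary_in_closure_escaping by blast
qed

lemma bead_subset_fatou: "bead n \<subseteq> fatou_set wander"
proof -
  have "normal_family (bead n) (range (\<lambda>n. wander ^^ n))"
  proof (rule normal_family_iteratesI[OF open_bead])
    fix m :: "nat \<Rightarrow> nat" assume m: "filterlim m at_top sequentially"
    have "uniform_limit (bead n) (\<lambda>k. wander ^^ k) (\<lambda>_. 0) sequentially"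
      unfolding uniform_limit_iff
    proof (intro allI impI)
      fix e :: real assume "e > 0"
      have "(\<lambda>k. (1/2) ^ k * 2 :: real) \<longlonglongrightarrow> 0 * 2" by (intro tendsto_intros LIMSEQ_power_zero) simp
      then have "eventually (\<lambda>k. (1/2) ^ k * 2 < e) sequentially"
        using \<open>e > 0\<close> order_tendstoD(2) by fastforce
      then show "\<forall>\<^sub>F k in sequentially. \<forall>v\<in>bead n. dist ((wander ^^ k) v) 0 < e"
      proof (rule eventually_mono, intro ballI)
        fix k v assume k: "(1/2) ^ k * 2 < e" and v: "v \<in> bead n"
        then have c: "v \<in> bead_chain" using bead_subset_chain by blast
        then have "norm v \<le> 2"
          using norm_plane_le[of v] bead_height_bound[of "v$1"] unfolding bead_chain_def by auto
        then have "(1/2) ^ k * norm v \<le> (1/2) ^ k * 2" by (intro mult_left_mono) auto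
        moreover have "dist ((wander ^^ k) v) 0 = (1/2) ^ k * norm v"
          by (simp add: funpow_wander_bead_chain(1)[OF c])
        ultimately show "dist ((wander ^^ k) v) 0 < e" using k by linarith
      qed
    qed
    then have unif: "uniform_limit (bead n) (\<lambda>k. wander ^^ m k) (\<lambda>_. 0) sequentially"
      using m unfolding uniform_limit_iff by (auto simp: filterlim_iff)
    have cont0: "isCont to_sphere 0"
      using to_sphere_continuous[of UNIV] by (simp add: continuous_on_eq_continuous_at)
    have "uniform_limit (bead n) (\<lambda>k. to_sphere \<circ> (wander ^^ m k)) (\<lambda>_. to_sphere 0) sequentially"
      unfolding uniform_limit_iff
    proof (intro allI impI)
      fix e :: real assume "e > 0"
      then obtain d where d: "d > 0" "\<And>w. dist w 0 < d \<Longrightarrow> dist (to_sphere w) (to_sphere 0) < e"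
        using cont0 unfolding continuous_at_eps_delta by blast
      from unif d(1) have "\<forall>\<^sub>F k in sequentially. \<forall>v\<in>bead n. dist ((wander ^^ m k) v) 0 < d"
        unfolding uniform_limit_iff by blast
      then show "\<forall>\<^sub>F k in sequentially. \<forall>v\<in>bead n. dist ((to_sphere \<circ> (wander ^^ m k)) v) (to_sphere 0) < e"
        by (rule eventually_mono) (use d(2) in simp)
    qed
    then have "locally_uniform_limit (bead n) (\<lambda>k. to_sphere \<circ> (wander ^^ m k)) (\<lambda>_. to_sphere 0)"
      unfolding locally_uniform_limit_def using open_bead by blast
    then show "\<exists>r g. strict_mono r \<and> g ` bead n \<subseteq> sphere 0 1 \<and>
        locally_uniform_limit (bead n) (\<lambda>k. to_sphere \<circ> (wander ^^ m (r k))) g"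
      using norm_to_sphere[of 0] by (intro exI[of _ "\<lambda>k. k"] exI[of _ "\<lambda>_. to_sphere 0"])
        (auto simp: strict_mono_def)
  qed
  then show ?thesis using open_bead by (auto simp: fatou_set_def)
qed

lemma bead_component_fatou: "bead n \<in> components (fatou_set wander)"
proof (rule connected_in_components_if_frontier_disjoint[OF connected_bead _ bead_subset_fatou])
  show "bead n \<noteq> {}" using bead_nonempty by blast
  have "z \<notin> fatou_set wander" if z: "z \<in> frontier (bead n)" for z
  proof (rule not_in_fatou_set[OF continuous_on_wander])
    show "z \<in> closure (escaping_set wander)"
      using frontier_bead[OF z] by (rule chain_boundary_in_closure_escaping)
    show "z \<in> closure (bead n)" using z by (simp add: frontier_def)
    show "(\<lambda>k. (wander ^^ k) w) \<longlonglongrightarrow> 0" if "w \<in> bead n" for w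
      using bead_chain_tendsto_0 bead_subset_chain that by blast
  qed
  then show "frontier (bead n) \<inter> fatou_set wander = {}" by blast
qed

text \<open>A boundary point of the chain has a neighbourhood whose non-escaping points lie in the chain with positive
abscissa, and these stay at positive abscissa forever. The forward images therefore omit at
least two non-escaping points of the nonpositive horizontal axis.\<close>

lemma julia_ne_frontier: "julia_set wander \<noteq> frontier (escaping_set wander)"
proof -
  define z where "z = pt (3/4) (bead_height (3/4))"
  have z: "0 < z$1" "z$1 < 1" "\<bar>z$2\<bar> = bead_height (z$1)"
    using bead_height_nonneg[of "3/4"] by (auto simp: z_def)
  have "z \<in> bead_chain" using z by (simp add: bead_chain_def)
  then have "z \<in> frontier (escaping_set wander)"
    using chain_boundary_in_closure_escaping[OF z] bead_chain_not_escaping open_escaping_set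
    by (simp add: frontier_def interior_open)
  moreover have "z \<notin> julia_set wander"
  proof
    assume "z \<in> julia_set wander"
    obtain U where U: "open U" "z \<in> U" "\<And>v. v \<in> U \<Longrightarrow> 0 < v$1 \<and> v$1 < 1"
      "\<And>v. v \<in> U \<Longrightarrow> bead_height (v$1) < \<bar>v$2\<bar> \<Longrightarrow> v \<in> escaping_set wander"
      using escaping_near_chain[OF z(1,2)] z(3) by (metis order_refl)
    have omitted: "pt x 0 \<notin> (\<Union>n. (wander ^^ n) ` U)" if x: "- 1 \<le> x" "x \<le> 0" for x
    proof
      assume "pt x 0 \<in> (\<Union>n. (wander ^^ n) ` U)"
      then obtain n v where v: "v \<in> U" "pt x 0 = (wander ^^ n) v" by blast
      have "pt x 0 \<in> bead_chain" using x bead_height_nonneg[of x] by (simp add: bead_chain_def)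
      then have "v \<notin> escaping_set wander"
        using bead_chain_not_escaping funpow_in_escaping_set[of n wander v] v(2) by auto
      then have "\<not> bead_height (v$1) < \<bar>v$2\<bar>" using U(4)[OF v(1)] by blast
      then have "v \<in> bead_chain" using U(3)[OF v(1)] by (simp add: bead_chain_def)
      then have "pt x 0 = (1/2) ^ n *\<^sub>R v" using funpow_wander_bead_chain(1) v(2) by simp
      from arg_cong[OF this, of "\<lambda>w. w$1"] have "x = (1/2) ^ n * v$1" by simp
      moreover have "0 < (1/2) ^ n * v$1" using U(3)[OF v(1)] by simp
      ultimately show False using x by simp
    qed
    obtain a where a: "UNIV - {a} \<subseteq> (\<Union>n. (wander ^^ n) ` U)"
      using \<open>z \<in> julia_set wander\<close> U(1,2) unfolding julia_set_def by blast
    have "w = a" if "w \<notin> (\<Union>n. (wander ^^ n) ` U)" for w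
    proof (rule ccontr)
      assume "w \<noteq> a"
      then have "w \<in> UNIV - {a}" by simp
      then have "w \<in> (\<Union>n. (wander ^^ n) ` U)" by (rule subsetD[OF a])
      then show False using that by (rule notE[rotated])
    qed
    note omitted_eq = this[OF omitted]
    have "pt 0 0 = a" "pt (- 1) 0 = a" by (rule omitted_eq; simp)+
    then show False using pt_simps(1)[of 0 0] pt_simps(1)[of "- 1" 0] by simp
  qed
  ultimately show ?thesis by blast
qed

theorem mainTheorem1:
  shows "\<exists>p :: plane \<Rightarrow> plane.
     quasiregular UNIV p \<and> polynomial_type p \<and>
     ereal_of_enat (map_degree p) > ereal (dilatation UNIV p) \<and>
     (\<exists>W. open W \<and> connected W \<and> W \<noteq> {} \<and>
          wandering_component p (UNIV - closure (escaping_set p)) W \<and>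
          wandering_component p (fatou_set p) W) \<and>
     julia_set p \<noteq> frontier (escaping_set p)"
proof (intro exI[of _ wander] exI[of _ "bead 0"] conjI)
  show qr: "quasiregular UNIV wander"
    using wander_K_quasiregular by (auto simp: quasiregular_def)
  have "wander (pt 0 1) \<noteq> wander (pt 0 0)"
  proof
    assume "wander (pt 0 1) = wander (pt 0 0)"
    moreover have "wander (pt 0 0) = 0"
      using wander_near[of "pt 0 0"] by (simp add: plane_eq_iff bead_height_def tent_outside)
    ultimately show False using wander_vertical(2)[of "pt 0 1"] by simp
  qed
  then have "\<not> wander constant_on UNIV" unfolding constant_on_def by (metis UNIV_I)
  then show "polynomial_type wander"
    using qr filterlim_wander_at_infinity by (simp add: polynomial_type_def)
  have "dilatation UNIV wander \<le> 9/2"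
    unfolding dilatation_def
  proof (rule cInf_lower)
    show "9/2 \<in> {K. K_quasiregular K UNIV wander}" using wander_K_quasiregular by simp
    show "bdd_below {K. K_quasiregular K UNIV wander}"
      by (rule bdd_belowI[of _ 1]) (auto simp: K_quasiregular_def)
  qed
  then have "ereal (dilatation UNIV wander) < ereal_of_enat 5"
    by (simp add: numeral_eq_enat)
  also have "\<dots> \<le> ereal_of_enat (map_degree wander)" using wander_degree by simp
  finally show "ereal (dilatation UNIV wander) < ereal_of_enat (map_degree wander)" .
  show "open (bead 0)" "connected (bead 0)" "bead 0 \<noteq> {}"
    using open_bead connected_bead bead_nonempty by blast+
  show "wandering_component wander (UNIV - closure (escaping_set wander)) (bead 0)"
    by (rule wandering_componentI[OF _ completely_invariant_escaping_closure[OF continuous_on_wander open_wander]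
          bead_component_closure wander_bead inj_bead]) (auto simp: open_Diff)
  show "wandering_component wander (fatou_set wander) (bead 0)"
    by (rule wandering_componentI[OF open_fatou_set completely_invariant_fatou_set[OF continuous_on_wander open_wander]
          bead_component_fatou wander_bead inj_bead])
  show "julia_set wander \<noteq> frontier (escaping_set wander)" by (rule julia_ne_frontier)
qed

end
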